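(* For every $n\geq1$ and every isotropic log-concave probability measure $\mu$ on $\mathbb{R}^n$, $$\Gamma^{(s)}(\mu):=\sup\{\mu^+(\partial A): A\subset\mathbb{R}^n \text{ a symmetric convex body}\}\leq 4n.$$
   Context: A convex body is a compact convex set with nonempty interior; it is symmetric if $A=-A$. $B_2^n$ is the Euclidean unit ball. For a Borel probability measure $\mu$ on $\mathbb{R}^n$ and a convex body $A$, $\mu^+(\partial A)=\liminf_{\epsilon\to0^+}\frac{\mu((A+\epsilon B_2^n)\setminus A)}{\epsilon}$. A probability measure on $\mathbb{R}^n$ is log-concave (full-dimensional) if it has a density $f$ with $\ln f$ concave (allowing value $-\infty$); it is isotropic if its barycenter is $0$ and its covariance matrix is the identity. *)

theory Defs
  imports "HOL-Probability.Probability"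
begin

text \<open>A (full-dimensional) log-concave probability measure: it has a density f
  w.r.t. Lebesgue measure with ln f concave (value -infinity allowed), i.e.
  f((1-t)x+ty) >= f(x)^(1-t) f(y)^t for 0<t<1.\<close>
definition log_concave_measure :: "'a::euclidean_space measure \<Rightarrow> bool" where
  "log_concave_measure M \<longleftrightarrow> prob_space M \<and>
     (\<exists>f :: 'a \<Rightarrow> real. f \<in> borel_measurable lborel \<and> (\<forall>x. 0 \<le> f x) \<and>
        M = density lborel (\<lambda>x. ennreal (f x)) \<and>
        (\<forall>x y t. 0 < t \<and> t < 1 \<longrightarrow>
            f x powr (1 - t) * f y powr t \<le> f ((1 - t) *\<^sub>R x + t *\<^sub>R y)))"

definition isotropic :: "'a::euclidean_space measure \<Rightarrow> bool" where
  "isotropic M \<longleftrightarrow>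
     integrable M (\<lambda>x. x) \<and> (\<integral>x. x \<partial>M) = 0 \<and>
     (\<forall>i\<in>Basis. \<forall>j\<in>Basis. integrable M (\<lambda>x. (x \<bullet> i) * (x \<bullet> j)) \<and>
        (\<integral>x. (x \<bullet> i) * (x \<bullet> j) \<partial>M) = (if i = j then 1 else 0))"

definition symmetric_convex_body :: "'a::euclidean_space set \<Rightarrow> bool" where
  "symmetric_convex_body A \<longleftrightarrow> compact A \<and> convex A \<and> interior A \<noteq> {} \<and>
     uminus ` A = A"

definition boundary_measure :: "'a::euclidean_space measure \<Rightarrow> 'a set \<Rightarrow> ereal" where
  "boundary_measure M A =
     Liminf (at_right 0) (\<lambda>\<epsilon>::real.
        ereal (measure M ({a + b | a b. a \<in> A \<and> b \<in> cball 0 \<epsilon>} - A) / \<epsilon>))"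

end

theory Submission
  imports Defs
begin

text \<open>Let \<open>r\<close> be the inradius of \<open>A\<close>. By symmetry \<open>A\<close> lies between the ball of radius \<open>r\<close> around
  \<open>0\<close> and a slab of half-width \<open>r\<close>, so the \<open>\<epsilon>\<close>-neighbourhood of \<open>A\<close> is contained in
  \<open>(1 + \<epsilon>/r)A\<close>. Log-concavity between \<open>0\<close> and \<open>s x\<close> gives
  \<open>f (s x) \<le> f x (f x / f 0)\<^sup>s\<^sup>-\<^sup>1\<close>, and \<open>f \<le> e\<^sup>n f 0\<close> because the barycenter is \<open>0\<close>
  (Fradelizi); hence \<open>\<mu>(sA) \<le> s\<^sup>n e\<^sup>n\<^sup>(\<^sup>s\<^sup>-\<^sup>1\<^sup>) \<mu>(A)\<close>, and differentiating at \<open>s = 1\<close> bounds the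
  boundary measure by \<open>(2n/r) \<mu>(A)\<close>.

  It remains to see that the slab has measure at most \<open>2r\<close>. Sliding it along its normal, one gets by
  Prekopa-Leindler a log-concave density \<open>\<psi>\<close> on the line, centered and of variance at least \<open>1\<close>.
  Integrating \<open>\<psi> 0 \<psi> (s + t) \<le> \<psi> s \<psi> t\<close> against \<open>1\<close> and \<open>s\<close> over each of the two quadrants
  where \<open>s, t\<close> have the same sign bounds the first and second half-line moments by the mass, and
  yields \<open>\<psi> 0 \<le> 1\<close>.\<close>

section \<open>Brunn-Minkowski and Prekopa-Leindler\<close>

lemma emeasure_lborel_affine_image:
  fixes A :: "real set" and c d :: real
  assumes [measurable]: "A \<in> sets borel" and c: "0 < c"
  shows "(\<lambda>x. d + c * x) ` A \<in> sets borel"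
    and "emeasure lborel ((\<lambda>x. d + c * x) ` A) = ennreal c * emeasure lborel A"
proof -
  have eq: "(\<lambda>x. d + c * x) ` A = (\<lambda>z. (z - d) / c) -` A"
  proof (intro equalityI subsetI)
    fix z assume "z \<in> (\<lambda>z. (z - d) / c) -` A"
    then show "z \<in> (\<lambda>x. d + c * x) ` A"
      using c by (intro image_eqI[of _ _ "(z - d) / c"]) auto
  qed (use c in auto)
  have "(\<lambda>z. (z - d) / c) -` A \<inter> space borel \<in> sets borel"
    by (rule measurable_sets[where A=borel]) auto
  then show *: "(\<lambda>x. d + c * x) ` A \<in> sets borel"
    by (simp add: eq)
  have "emeasure lborel ((\<lambda>x. d + c * x) ` A) = (\<integral>\<^sup>+z. indicator ((\<lambda>x. d + c * x) ` A) z \<partial>lborel)"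
    using * by simp
  also have "\<dots> = ennreal \<bar>c\<bar> * (\<integral>\<^sup>+x. indicator ((\<lambda>x. d + c * x) ` A) (d + c * x) \<partial>lborel)"
    using * c by (intro nn_integral_real_affine) auto
  also have "(\<lambda>x. indicator ((\<lambda>x. d + c * x) ` A) (d + c * x) :: ennreal) = indicator A"
    using c by (auto simp: fun_eq_iff indicator_def image_iff)
  finally show "emeasure lborel ((\<lambda>x. d + c * x) ` A) = ennreal c * emeasure lborel A"
    using c by simp
qed

text \<open>Place the shrunken copies \<open>(1 - t) * A + t * b\<close> and
  \<open>(1 - t) * a + t * B\<close> side by side, with \<open>a\<close> near the top of
  \<open>A\<close> and \<open>b\<close> near the bottom of \<open>B\<close>. Both lie in
  \<open>C\<close> and meet only inside an interval of length at most \<open>e\<close>. Extremal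
  points need not be attained, hence the slack \<open>e\<close>.\<close>

lemma Brunn_Minkowski_real_bounded:
  fixes A B C :: "real set"
  assumes AB: "A \<in> sets borel" "B \<in> sets borel" and [measurable]: "C \<in> sets borel"
    and ne: "A \<noteq> {}" "B \<noteq> {}" and bd: "bounded A" "bounded B" and t: "0 < t" "t < 1"
    and C: "\<And>a b. a \<in> A \<Longrightarrow> b \<in> B \<Longrightarrow> (1 - t) * a + t * b \<in> C"
  shows "ennreal (1 - t) * emeasure lborel A + ennreal t * emeasure lborel B \<le> emeasure lborel C"
proof (rule ennreal_le_epsilon)
  fix e :: real assume e: "0 < e"
  have bA: "bdd_above A" and bB: "bdd_below B"
    using bd by (auto simp: bounded_imp_bdd_above bounded_imp_bdd_below)
  obtain a where a: "a \<in> A" "Sup A - e < a"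
    using less_cSup_iff[OF ne(1) bA, of "Sup A - e"] e by auto
  obtain b where b: "b \<in> B" "b < Inf B + e"
    using cInf_less_iff[OF ne(2) bB, of "Inf B + e"] e by auto
  let ?A = "(\<lambda>x. t * b + (1 - t) * x) ` A" and ?B = "(\<lambda>x. (1 - t) * a + t * x) ` B"
  have mA: "?A \<in> sets borel" "emeasure lborel ?A = ennreal (1 - t) * emeasure lborel A"
    and mB: "?B \<in> sets borel" "emeasure lborel ?B = ennreal t * emeasure lborel B"
    using emeasure_lborel_affine_image[OF AB(1), of "1 - t" "t * b"]
      emeasure_lborel_affine_image[OF AB(2), of t "(1 - t) * a"] t by auto
  have "?A \<inter> ?B \<subseteq> {(1 - t) * a + t * Inf B .. t * b + (1 - t) * Sup A}"
  proof
    fix z assume "z \<in> ?A \<inter> ?B"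
    then obtain x y where "x \<in> A" "y \<in> B" "z = t * b + (1 - t) * x" "z = (1 - t) * a + t * y"
      by auto
    moreover have "(1 - t) * x \<le> (1 - t) * Sup A" "t * Inf B \<le> t * y"
      using \<open>x \<in> A\<close> \<open>y \<in> B\<close> t bA bB by (auto intro!: mult_left_mono cSup_upper cInf_lower)
    ultimately show "z \<in> {(1 - t) * a + t * Inf B .. t * b + (1 - t) * Sup A}"
      by auto
  qed
  then have "emeasure lborel (?A \<inter> ?B) \<le> emeasure lborel {(1 - t) * a + t * Inf B .. t * b + (1 - t) * Sup A}"
    by (intro emeasure_mono) auto
  also have "\<dots> \<le> ennreal e"
  proof -
    have "(1 - t) * (Sup A - a) + t * (b - Inf B) \<le> (1 - t) * e + t * e"
      using t a b by (intro add_mono mult_left_mono) auto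
    then have "t * b + (1 - t) * Sup A - ((1 - t) * a + t * Inf B) \<le> e"
      by (simp add: algebra_simps)
    then show ?thesis
      using e by (auto simp: emeasure_lborel_Icc_eq intro!: ennreal_leI)
  qed
  finally have Int: "emeasure lborel (?A \<inter> ?B) \<le> ennreal e" .
  have "?A \<union> ?B \<subseteq> C"
    using C a b by (auto simp: add.commute)
  then have Un: "emeasure lborel (?A \<union> ?B) \<le> emeasure lborel C"
    by (intro emeasure_mono) auto
  have "emeasure lborel ?A + emeasure lborel ?B = emeasure lborel (?A \<union> ?B) + emeasure lborel (?A \<inter> ?B)"
    using mA mB by (intro emeasure_Un_Int) auto
  also have "\<dots> \<le> emeasure lborel C + ennreal e"
    using Int Un by (rule add_mono[rotated])
  finally show "ennreal (1 - t) * emeasure lborel A + ennreal t * emeasure lborel B \<le> emeasure lborel C + ennreal e"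
    by (simp add: mA mB)
qed

lemma Brunn_Minkowski_real:
  fixes A B C :: "real set"
  assumes AB[measurable]: "A \<in> sets borel" "B \<in> sets borel" "C \<in> sets borel"
    and ne: "A \<noteq> {}" "B \<noteq> {}" and t: "0 < t" "t < 1"
    and C: "\<And>a b. a \<in> A \<Longrightarrow> b \<in> B \<Longrightarrow> (1 - t) * a + t * b \<in> C"
  shows "ennreal (1 - t) * emeasure lborel A + ennreal t * emeasure lborel B \<le> emeasure lborel C"
proof -
  obtain a b where ab: "a \<in> A" "b \<in> B" using ne by auto
  \<comment> \<open>Every window contains \<open>a\<close> and \<open>b\<close>, so the truncated
    sets are never empty. \<open>C\<close> stays whole because it still contains all combinations of
    truncated points.\<close>
  define I where "I n = {- (\<bar>a\<bar> + \<bar>b\<bar> + real n) .. \<bar>a\<bar> + \<bar>b\<bar> + real n}" for n :: nat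
  have I: "incseq I"
    by (auto simp: I_def incseq_def)
  have UI: "(\<Union>n. I n) = UNIV"
  proof -
    have "\<exists>n. x \<in> I n" for x
    proof -
      obtain n where "\<bar>x\<bar> \<le> real n" using real_arch_simple by blast
      then show ?thesis by (intro exI[of _ n]) (auto simp: I_def)
    qed
    then show ?thesis by auto
  qed
  have lim: "(\<lambda>n. emeasure lborel (X \<inter> I n)) \<longlonglongrightarrow> emeasure lborel X" if X: "X \<in> sets borel" for X
  proof -
    have "(\<lambda>n. emeasure lborel (X \<inter> I n)) \<longlonglongrightarrow> emeasure lborel (\<Union>n. X \<inter> I n)"
      using X I by (intro Lim_emeasure_incseq) (auto simp: incseq_def I_def)
    then show ?thesis using UI by (simp add: Int_UN_distrib[symmetric])
  qed
  have "(\<lambda>n. ennreal (1 - t) * emeasure lborel (A \<inter> I n) + ennreal t * emeasure lborel (B \<inter> I n))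
     \<longlonglongrightarrow> ennreal (1 - t) * emeasure lborel A + ennreal t * emeasure lborel B"
    using AB by (intro tendsto_add ennreal_tendsto_cmult lim) auto
  then show ?thesis
  proof (rule LIMSEQ_le_const2, intro exI allI impI)
    fix n :: nat
    have "a \<in> I n" "b \<in> I n" by (auto simp: I_def)
    then show "ennreal (1 - t) * emeasure lborel (A \<inter> I n) + ennreal t * emeasure lborel (B \<inter> I n) \<le> emeasure lborel C"
      using ab t by (intro Brunn_Minkowski_real_bounded C) (auto simp: I_def bounded_Int)
  qed
qed

text \<open>\<open>c\<close> dominates the weighted geometric mean of \<open>a\<close> and \<open>b\<close>; with real minorants no power
  function on \<^typ>\<open>ennreal\<close> is needed and infinite integrals require no special treatment.\<close>
definition gm_le :: "real \<Rightarrow> ennreal \<Rightarrow> ennreal \<Rightarrow> ennreal \<Rightarrow> bool" where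
  "gm_le t a b c \<longleftrightarrow> (\<forall>u v. 0 < u \<longrightarrow> 0 < v \<longrightarrow> ennreal u \<le> a \<longrightarrow> ennreal v \<le> b \<longrightarrow>
     ennreal (u powr (1 - t) * v powr t) \<le> c)"

section \<open>Prekopa-Leindler inequality: on the line, then in products\<close>

lemma powr_weighted_mult:
  fixes e a b t :: real
  assumes "0 < e" "0 < a" "0 < b"
  shows "(e * a) powr (1 - t) * (e * b) powr t = e * (a powr (1 - t) * b powr t)"
proof -
  have "(e * a) powr (1 - t) * (e * b) powr t = (e powr (1 - t) * e powr t) * (a powr (1 - t) * b powr t)"
    using assms by (simp add: powr_mult mult_ac)
  also have "e powr (1 - t) * e powr t = e"
    using assms by (simp add: powr_add[symmetric])
  finally show ?thesis .
qed

text \<open>Tonelli: for fixed \<open>x\<close>, the levels \<open>s\<close> in (0,1) lying below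
  \<open>u x\<close> form an interval of length \<open>min 1 (u x)\<close>. Levels stop at 1 because
  the functions are used after division by their suprema.\<close>

lemma layer_cake_min:
  fixes u :: "real \<Rightarrow> ennreal"
  assumes [measurable]: "u \<in> borel_measurable borel"
  shows "(\<integral>\<^sup>+s. emeasure lborel {x. ennreal s < u x} * indicator {0<..<1} s \<partial>lborel) =
    (\<integral>\<^sup>+x. min 1 (u x) \<partial>lborel)"
proof -
  have "(\<integral>\<^sup>+s. emeasure lborel {x. ennreal s < u x} * indicator {0<..<1} s \<partial>lborel) =
      (\<integral>\<^sup>+s. \<integral>\<^sup>+x. indicator {x. ennreal s < u x} x * indicator {0<..<1} s \<partial>lborel \<partial>lborel)"
    by (intro nn_integral_cong) (simp add: nn_integral_multc)
  also have "\<dots> = (\<integral>\<^sup>+x. \<integral>\<^sup>+s. indicator {x. ennreal s < u x} x * indicator {0<..<1} s \<partial>lborel \<partial>lborel)"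
    by (rule lborel_pair.Fubini') measurable
  also have "\<dots> = (\<integral>\<^sup>+x. min 1 (u x) \<partial>lborel)"
  proof (rule nn_integral_cong)
    fix x
    show "(\<integral>\<^sup>+s. indicator {x. ennreal s < u x} x * indicator {0<..<1} s \<partial>lborel) = min 1 (u x)"
    proof (cases "u x")
      case (real r)
      have "(\<integral>\<^sup>+s. indicator {x. ennreal s < u x} x * indicator {0<..<1} s \<partial>lborel) =
        (\<integral>\<^sup>+s. indicator {0<..<min 1 r} s \<partial>lborel)"
        using real by (intro nn_integral_cong) (auto simp: indicator_def ennreal_less_iff)
      also have "\<dots> = ennreal (min 1 r)"
        using real by simp
      finally show ?thesis
        using real by (auto simp: min_def)
    next
      case top
      then have "(\<integral>\<^sup>+s. indicator {x. ennreal s < u x} x * indicator {0<..<1} s \<partial>lborel) =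
        (\<integral>\<^sup>+s. indicator {0<..<1::real} s \<partial>lborel)"
        by (intro nn_integral_cong) (auto simp: indicator_def)
      then show ?thesis
        using top by simp
    qed
  qed
  finally show ?thesis .
qed

text \<open>Divide \<open>f\<close> and \<open>g\<close> by their suprema \<open>\<alpha>\<close>,
  \<open>\<beta>\<close>, and \<open>h\<close> by the weighted geometric mean \<open>k\<close>. At
  each level in (0,1) the superlevel sets of \<open>f\<close> and \<open>g\<close> are then
  nonempty, so Brunn-Minkowski on the line applies; integrating over levels bounds a weighted
  arithmetic mean of the integrals. Weighted AM-GM turns it into a geometric mean, and the
  normalizing factors cancel.\<close>

lemma Prekopa_Leindler_real_bounded:
  fixes f g h :: "real \<Rightarrow> ennreal"
  assumes [measurable]: "f \<in> borel_measurable borel" "g \<in> borel_measurable borel" "h \<in> borel_measurable borel"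
    and t: "0 < t" "t < 1"
    and bd: "\<And>x. f x \<le> ennreal K" "\<And>x. g x \<le> ennreal K"
    and fgh: "\<And>x y. gm_le t (f x) (g y) (h ((1 - t) * x + t * y))"
    and c: "0 < c" "ennreal c \<le> (\<integral>\<^sup>+x. f x \<partial>lborel)"
    and d: "0 < d" "ennreal d \<le> (\<integral>\<^sup>+x. g x \<partial>lborel)"
  shows "ennreal (c powr (1 - t) * d powr t) \<le> (\<integral>\<^sup>+x. h x \<partial>lborel)"
proof -
  have sup: "\<exists>\<alpha>>0. (SUP x. f x) = ennreal \<alpha>" if "\<And>x. f x \<le> ennreal K" "0 < c" "ennreal c \<le> (\<integral>\<^sup>+x. f x \<partial>lborel)"
    for f :: "real \<Rightarrow> ennreal" and c
  proof -
    have "(SUP x. f x) \<le> ennreal K" using that by (intro SUP_least)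
    then obtain \<alpha> where \<alpha>: "0 \<le> \<alpha>" "(SUP x. f x) = ennreal \<alpha>"
      by (cases "SUP x. f x") (auto simp: top_unique)
    have "\<alpha> \<noteq> 0"
    proof
      assume "\<alpha> = 0"
      then have "f x = 0" for x
        using \<alpha> SUP_upper[of x UNIV f] by simp
      then show False using that by simp
    qed
    then show ?thesis using \<alpha> by (intro exI[of _ \<alpha>] conjI) (linarith, assumption)
  qed
  obtain \<alpha> where \<alpha>: "0 < \<alpha>" "(SUP x. f x) = ennreal \<alpha>"
    using sup[OF bd(1) c] by blast
  obtain \<beta> where \<beta>: "0 < \<beta>" "(SUP x. g x) = ennreal \<beta>"
    using sup[OF bd(2) d] by blast
  define k where "k = \<alpha> powr (1 - t) * \<beta> powr t"
  have k: "0 < k" using \<alpha> \<beta> by (simp add: k_def)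
  have lt: "ennreal s < ennreal (1 / a) * z \<longleftrightarrow> ennreal (s * a) < z" if "0 < a" "0 < s" for a s z
  proof (cases z)
    case (real r)
    have "s < 1 / a * r \<longleftrightarrow> s * a < r" using that by (simp add: field_simps)
    then show ?thesis
      using that real by (simp add: ennreal_mult[symmetric] ennreal_less_iff)
  next
    case top
    then show ?thesis using that by (simp add: ennreal_mult_top)
  qed
  have ex: "{x. ennreal s < ennreal (1 / a) * f x} \<noteq> {}"
    if "0 < s" "s < 1" "0 < a" "(SUP x. f x) = ennreal a" for s a and f :: "real \<Rightarrow> ennreal"
  proof -
    have "ennreal (s * a) < (SUP x. f x)" using that by (simp add: ennreal_less_iff)
    then obtain x where "ennreal (s * a) < f x" by (auto simp: less_SUP_iff)
    then show ?thesis using lt[of a s "f x"] that by auto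
  qed
  have BM: "ennreal (1 - t) * emeasure lborel {x. ennreal s < ennreal (1 / \<alpha>) * f x} +
      ennreal t * emeasure lborel {x. ennreal s < ennreal (1 / \<beta>) * g x}
      \<le> emeasure lborel {x. ennreal s < ennreal (1 / k) * h x}" if s: "0 < s" "s < 1" for s
  proof (rule Brunn_Minkowski_real)
    fix x y assume "x \<in> {x. ennreal s < ennreal (1 / \<alpha>) * f x}" "y \<in> {x. ennreal s < ennreal (1 / \<beta>) * g x}"
    then have xy: "ennreal (s * \<alpha>) < f x" "ennreal (s * \<beta>) < g y"
      using lt s \<alpha> \<beta> by auto
    obtain p where p: "f x = ennreal p" "0 \<le> p" using bd(1)[of x] by (cases "f x") (auto simp: top_unique)
    obtain q where q: "g y = ennreal q" "0 \<le> q" using bd(2)[of y] by (cases "g y") (auto simp: top_unique)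
    have pq: "s * \<alpha> < p" "s * \<beta> < q"
      using xy p q s \<alpha> \<beta> by (auto simp: ennreal_less_iff)
    have pos: "0 < s * \<alpha>" "0 < s * \<beta>" using s \<alpha> \<beta> by auto
    have "s * k = (s * \<alpha>) powr (1 - t) * (s * \<beta>) powr t"
      using s \<alpha> \<beta> by (simp add: k_def powr_weighted_mult)
    also have "\<dots> < p powr (1 - t) * q powr t"
      using pq pos t by (intro mult_strict_mono powr_less_mono2) auto
    finally have "ennreal (s * k) < ennreal (p powr (1 - t) * q powr t)"
      using s k by (simp add: ennreal_less_iff)
    also have "\<dots> \<le> h ((1 - t) * x + t * y)"
      using fgh[of x y] p q pq pos unfolding gm_le_def by auto
    finally show "(1 - t) * x + t * y \<in> {x. ennreal s < ennreal (1 / k) * h x}"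
      using lt[of k s] k s by auto
  qed (use t s ex \<alpha> \<beta> in auto)
  have int: "(\<integral>\<^sup>+s. emeasure lborel {x. ennreal s < ennreal (1 / a) * f x} * indicator {0<..<1} s \<partial>lborel)
      = ennreal (1 / a) * (\<integral>\<^sup>+x. f x \<partial>lborel)"
    if [measurable]: "f \<in> borel_measurable borel" and a: "0 < a" "(SUP x. f x) = ennreal a"
    for f :: "real \<Rightarrow> ennreal" and a
  proof -
    have "ennreal (1 / a) * f x \<le> 1" for x
    proof -
      have "ennreal (1 / a) * f x \<le> ennreal (1 / a) * ennreal a"
        using SUP_upper[of x UNIV f] a by (intro mult_left_mono) auto
      then show ?thesis using a by (simp add: ennreal_mult[symmetric])
    qed
    then show ?thesis
      by (subst layer_cake_min) (auto simp: min_absorb2 nn_integral_cmult)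
  qed
  have [measurable]: "(\<lambda>s. emeasure lborel {x. ennreal s < u x}) \<in> borel_measurable borel"
    if [measurable]: "u \<in> borel_measurable borel" for u :: "real \<Rightarrow> ennreal"
  proof -
    have "(\<lambda>s. \<integral>\<^sup>+x. indicator {x. ennreal s < u x} x \<partial>lborel) \<in> borel_measurable borel"
      by measurable
    then show ?thesis by simp
  qed
  have "ennreal (1 - t) * (ennreal (1 / \<alpha>) * (\<integral>\<^sup>+x. f x \<partial>lborel)) +
      ennreal t * (ennreal (1 / \<beta>) * (\<integral>\<^sup>+x. g x \<partial>lborel)) =
    (\<integral>\<^sup>+s. (ennreal (1 - t) * emeasure lborel {x. ennreal s < ennreal (1 / \<alpha>) * f x} +
      ennreal t * emeasure lborel {x. ennreal s < ennreal (1 / \<beta>) * g x}) * indicator {0<..<1} s \<partial>lborel)"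
    using \<alpha> \<beta> t by (simp add: int[symmetric] nn_integral_add nn_integral_cmult distrib_right mult.assoc)
  also have "\<dots> \<le> (\<integral>\<^sup>+s. emeasure lborel {x. ennreal s < ennreal (1 / k) * h x} * indicator {0<..<1} s \<partial>lborel)"
    using BM by (intro nn_integral_mono) (auto simp: indicator_def)
  \<comment> \<open>The normalized \<open>h\<close> may exceed 1, so the layer-cake integral gives
    only an upper bound here; for \<open>f\<close> and \<open>g\<close> it is exact.\<close>
  also have "\<dots> \<le> ennreal (1 / k) * (\<integral>\<^sup>+x. h x \<partial>lborel)"
    by (subst layer_cake_min) (auto simp: nn_integral_cmult[symmetric] intro!: nn_integral_mono)
  finally have main: "ennreal (1 - t) * (ennreal (1 / \<alpha>) * (\<integral>\<^sup>+x. f x \<partial>lborel)) +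
      ennreal t * (ennreal (1 / \<beta>) * (\<integral>\<^sup>+x. g x \<partial>lborel)) \<le> ennreal (1 / k) * (\<integral>\<^sup>+x. h x \<partial>lborel)" .
  show ?thesis
  proof (cases "\<integral>\<^sup>+x. h x \<partial>lborel")
    case (real \<eta>)
    have "ennreal (1 - t) * (ennreal (1 / \<alpha>) * ennreal c) + ennreal t * (ennreal (1 / \<beta>) * ennreal d)
      \<le> ennreal (1 / k) * ennreal \<eta>"
      using c d main unfolding real(2)[symmetric]
      by (intro order_trans[OF _ main] add_mono mult_left_mono) auto
    then have "(1 - t) * (c / \<alpha>) + t * (d / \<beta>) \<le> \<eta> / k"
      using c d \<alpha> \<beta> k t real
      by (simp add: ennreal_mult[symmetric] ennreal_plus[symmetric] ennreal_le_iff del: ennreal_plus)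
    moreover have "(c / \<alpha>) powr (1 - t) * (d / \<beta>) powr t \<le> (1 - t) * (c / \<alpha>) + t * (d / \<beta>)"
      using t c d \<alpha> \<beta> by (intro Youngs_inequality_0) auto
    ultimately have "(c / \<alpha>) powr (1 - t) * (d / \<beta>) powr t \<le> \<eta> / k" by linarith
    then have "c powr (1 - t) * d powr t \<le> \<eta>"
      using c d \<alpha> \<beta> k by (simp add: powr_divide k_def field_simps)
    then show ?thesis using real by (simp add: ennreal_leI)
  qed simp
qed

text \<open>Cut \<open>f\<close> and \<open>g\<close> off at a large height: by monotone convergence
  their integrals still exceed \<open>e * c\<close> and \<open>e * d\<close> for any
  \<open>e < 1\<close>. The geometric mean is homogeneous of degree one, so only a factor
  \<open>e\<close> is lost, and \<open>e\<close> tends to 1.\<close>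

lemma Prekopa_Leindler_real:
  fixes f g h :: "real \<Rightarrow> ennreal"
  assumes [measurable]: "f \<in> borel_measurable borel" "g \<in> borel_measurable borel" "h \<in> borel_measurable borel"
    and t: "0 < t" "t < 1"
    and fgh: "\<And>x y. gm_le t (f x) (g y) (h ((1 - t) * x + t * y))"
  shows "gm_le t (\<integral>\<^sup>+x. f x \<partial>lborel) (\<integral>\<^sup>+x. g x \<partial>lborel) (\<integral>\<^sup>+x. h x \<partial>lborel)"
  unfolding gm_le_def
proof (intro allI impI)
  fix c d :: real
  assume c: "0 < c" "ennreal c \<le> (\<integral>\<^sup>+x. f x \<partial>lborel)" and d: "0 < d" "ennreal d \<le> (\<integral>\<^sup>+x. g x \<partial>lborel)"
  have trunc: "\<exists>N::nat. \<forall>n\<ge>N. ennreal (e * c) \<le> (\<integral>\<^sup>+x. min (f x) (ennreal (real n)) \<partial>lborel)"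
    if [measurable]: "f \<in> borel_measurable borel" and c: "0 < c" "ennreal c \<le> (\<integral>\<^sup>+x. f x \<partial>lborel)"
      and e: "0 < e" "e < 1" for f :: "real \<Rightarrow> ennreal" and c e :: real
  proof -
    have sup: "(SUP n. min z (ennreal (real n))) = z" for z
    proof -
      have "(SUP n. inf z (of_nat n :: ennreal)) = inf z (SUP n. of_nat n)"
        by (rule inf_SUP[symmetric])
      then show ?thesis
        by (simp add: inf_min ennreal_of_nat_eq_real_of_nat[symmetric] ennreal_SUP_of_nat_eq_top)
    qed
    have "(\<integral>\<^sup>+x. f x \<partial>lborel) = (\<integral>\<^sup>+x. (SUP n. min (f x) (ennreal (real n))) \<partial>lborel)"
      by (simp add: sup)
    also have "\<dots> = (SUP n. \<integral>\<^sup>+x. min (f x) (ennreal (real n)) \<partial>lborel)"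
      by (intro nn_integral_monotone_convergence_SUP)
        (auto simp: incseq_def le_fun_def intro!: min.coboundedI2 ennreal_leI)
    finally have S: "(\<integral>\<^sup>+x. f x \<partial>lborel) = \<dots>" .
    have "ennreal (e * c) < ennreal c" using c e by (simp add: ennreal_less_iff)
    then have "ennreal (e * c) < (SUP n. \<integral>\<^sup>+x. min (f x) (ennreal (real n)) \<partial>lborel)"
      using c S by simp
    then obtain N where N: "ennreal (e * c) < (\<integral>\<^sup>+x. min (f x) (ennreal (real N)) \<partial>lborel)"
      by (auto simp: less_SUP_iff)
    show ?thesis
    proof (intro exI[of _ N] allI impI)
      fix n assume "N \<le> n"
      then have "(\<integral>\<^sup>+x. min (f x) (ennreal (real N)) \<partial>lborel) \<le> (\<integral>\<^sup>+x. min (f x) (ennreal (real n)) \<partial>lborel)"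
        by (intro nn_integral_mono min.mono ennreal_leI) auto
      then show "ennreal (e * c) \<le> (\<integral>\<^sup>+x. min (f x) (ennreal (real n)) \<partial>lborel)"
        using N by simp
    qed
  qed
  have le: "ennreal (e * (c powr (1 - t) * d powr t)) \<le> (\<integral>\<^sup>+x. h x \<partial>lborel)" if e: "0 < e" "e < 1" for e
  proof -
    obtain N1 :: nat where N1: "\<And>n. n \<ge> N1 \<Longrightarrow> ennreal (e * c) \<le> (\<integral>\<^sup>+x. min (f x) (ennreal (real n)) \<partial>lborel)"
      using trunc[OF _ c e] by auto
    obtain N2 :: nat where N2: "\<And>n. n \<ge> N2 \<Longrightarrow> ennreal (e * d) \<le> (\<integral>\<^sup>+x. min (g x) (ennreal (real n)) \<partial>lborel)"
      using trunc[OF _ d e] by auto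
    define n where "n = max N1 N2"
    have "ennreal ((e * c) powr (1 - t) * (e * d) powr t) \<le> (\<integral>\<^sup>+x. h x \<partial>lborel)"
    proof (rule Prekopa_Leindler_real_bounded[where K = "real n" and f = "\<lambda>x. min (f x) (ennreal (real n))" and g = "\<lambda>x. min (g x) (ennreal (real n))"])
      show "gm_le t (min (f x) (ennreal (real n))) (min (g y) (ennreal (real n))) (h ((1 - t) * x + t * y))" for x y
        using fgh[of x y] unfolding gm_le_def by auto
    qed (use N1 N2 c d e t in \<open>auto simp: n_def\<close>)
    also have "(e * c) powr (1 - t) * (e * d) powr t = e * (c powr (1 - t) * d powr t)"
      using e c d by (simp add: powr_weighted_mult)
    finally show ?thesis .
  qed
  show "ennreal (c powr (1 - t) * d powr t) \<le> (\<integral>\<^sup>+x. h x \<partial>lborel)"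
  proof (cases "\<integral>\<^sup>+x. h x \<partial>lborel")
    case (real \<eta>)
    have "e * (c powr (1 - t) * d powr t) \<le> \<eta>" if "0 < e" "e < 1" for e
      using le[OF that] real by (simp add: ennreal_le_iff)
    then have "c powr (1 - t) * d powr t \<le> \<eta>"
      by (rule field_le_mult_one_interval)
    then show ?thesis using real by (simp add: ennreal_leI)
  qed simp
qed

text \<open>Tensorization: with the coordinates in \<open>I\<close> fixed, the one-dimensional
  inequality in coordinate \<open>i\<close> shows that the section integrals again satisfy
  \<open>gm_le\<close>, which is the hypothesis of the induction for \<open>I\<close>. Points are
  taken in \<open>extensional I\<close>, the carrier of the product measure.\<close>

lemma Prekopa_Leindler_PiM:
  fixes f g h :: "('i \<Rightarrow> real) \<Rightarrow> ennreal"
  assumes "finite I" and t: "0 < t" "t < 1"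
    and "f \<in> borel_measurable (Pi\<^sub>M I (\<lambda>_. lborel))" "g \<in> borel_measurable (Pi\<^sub>M I (\<lambda>_. lborel))"
      "h \<in> borel_measurable (Pi\<^sub>M I (\<lambda>_. lborel))"
    and "\<And>x y. x \<in> extensional I \<Longrightarrow> y \<in> extensional I \<Longrightarrow>
      gm_le t (f x) (g y) (h (\<lambda>i\<in>I. (1 - t) * x i + t * y i))"
  shows "gm_le t (\<integral>\<^sup>+x. f x \<partial>Pi\<^sub>M I (\<lambda>_. lborel)) (\<integral>\<^sup>+x. g x \<partial>Pi\<^sub>M I (\<lambda>_. lborel))
    (\<integral>\<^sup>+x. h x \<partial>Pi\<^sub>M I (\<lambda>_. lborel))"
  using assms(1,4-)
proof (induction I arbitrary: f g h)
  case empty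
  interpret product_sigma_finite "\<lambda>_::'i. lborel :: real measure" ..
  \<comment> \<open>The empty product is a point mass at the function that is
    \<open>undefined\<close> everywhere, so the hypothesis at that single point is the
    claim.\<close>
  show ?case
    using empty(4)[of "\<lambda>_. undefined" "\<lambda>_. undefined"]
    by (simp add: nn_integral_empty restrict_def)
next
  case (insert i I)
  interpret product_sigma_finite "\<lambda>_::'i. lborel :: real measure" ..
  have upd: "(\<lambda>(x, y). f (x(i := y))) \<in> borel_measurable (Pi\<^sub>M I (\<lambda>_. lborel) \<Otimes>\<^sub>M lborel)"
    if "f \<in> borel_measurable (Pi\<^sub>M (insert i I) (\<lambda>_. lborel))" for f :: "('i \<Rightarrow> real) \<Rightarrow> ennreal"
    using measurable_comp[OF measurable_add_dim that] by (simp add: comp_def case_prod_beta')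
  have sec: "(\<lambda>y. f (x(i := y))) \<in> borel_measurable borel"
    if "f \<in> borel_measurable (Pi\<^sub>M (insert i I) (\<lambda>_. lborel))" "x \<in> extensional I"
    for f :: "('i \<Rightarrow> real) \<Rightarrow> ennreal" and x
    using measurable_Pair2[OF upd[OF that(1)], of x] that(2) by (simp add: space_PiM PiE_def)
  have meas: "(\<lambda>x. \<integral>\<^sup>+y. f (x(i := y)) \<partial>lborel) \<in> borel_measurable (Pi\<^sub>M I (\<lambda>_. lborel))"
    if "f \<in> borel_measurable (Pi\<^sub>M (insert i I) (\<lambda>_. lborel))" for f :: "('i \<Rightarrow> real) \<Rightarrow> ennreal"
    using upd[OF that] by (rule lborel.borel_measurable_nn_integral)
  have "gm_le t (\<integral>\<^sup>+x. \<integral>\<^sup>+y. f (x(i := y)) \<partial>lborel \<partial>Pi\<^sub>M I (\<lambda>_. lborel))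
      (\<integral>\<^sup>+x. \<integral>\<^sup>+y. g (x(i := y)) \<partial>lborel \<partial>Pi\<^sub>M I (\<lambda>_. lborel))
      (\<integral>\<^sup>+x. \<integral>\<^sup>+y. h (x(i := y)) \<partial>lborel \<partial>Pi\<^sub>M I (\<lambda>_. lborel))"
  proof (rule insert.IH)
    fix x y :: "'i \<Rightarrow> real" assume xy: "x \<in> extensional I" "y \<in> extensional I"
    have z: "(\<lambda>j\<in>I. (1 - t) * x j + t * y j) \<in> extensional I" by simp
    show "gm_le t (\<integral>\<^sup>+a. f (x(i := a)) \<partial>lborel) (\<integral>\<^sup>+a. g (y(i := a)) \<partial>lborel)
      (\<integral>\<^sup>+a. h ((\<lambda>j\<in>I. (1 - t) * x j + t * y j)(i := a)) \<partial>lborel)"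
    proof (rule Prekopa_Leindler_real)
      fix a b
      have "(\<lambda>j\<in>insert i I. (1 - t) * (x(i := a)) j + t * (y(i := b)) j)
         = (\<lambda>j\<in>I. (1 - t) * x j + t * y j)(i := (1 - t) * a + t * b)"
        using insert.hyps by (auto simp: fun_eq_iff restrict_def)
      moreover have "x(i := a) \<in> extensional (insert i I)" "y(i := b) \<in> extensional (insert i I)"
        using xy by (auto simp: extensional_def)
      ultimately show "gm_le t (f (x(i := a))) (g (y(i := b)))
          (h ((\<lambda>j\<in>I. (1 - t) * x j + t * y j)(i := (1 - t) * a + t * b)))"
        using insert.prems(4)[of "x(i := a)" "y(i := b)"] by (simp del: fun_upd_apply)
    qed (use t xy z sec insert.prems in auto)
  qed (intro meas insert.prems)+
  then show ?case
    using insert by (simp add: product_nn_integral_insert)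
qed

lemma nn_integral_lborel_PiM:
  fixes f :: "'a::euclidean_space \<Rightarrow> ennreal"
  assumes "f \<in> borel_measurable borel"
  shows "(\<integral>\<^sup>+x. f x \<partial>lborel) = (\<integral>\<^sup>+x. f (\<Sum>b\<in>Basis. x b *\<^sub>R b) \<partial>Pi\<^sub>M Basis (\<lambda>_. lborel))"
  using assms by (subst lborel_eq) (simp add: nn_integral_distr)

lemma Prekopa_Leindler:
  fixes f g h :: "'a::euclidean_space \<Rightarrow> ennreal"
  assumes [measurable]: "f \<in> borel_measurable borel" "g \<in> borel_measurable borel" "h \<in> borel_measurable borel"
    and t: "0 < t" "t < 1"
    and fgh: "\<And>x y. gm_le t (f x) (g y) (h ((1 - t) *\<^sub>R x + t *\<^sub>R y))"
  shows "gm_le t (\<integral>\<^sup>+x. f x \<partial>lborel) (\<integral>\<^sup>+x. g x \<partial>lborel) (\<integral>\<^sup>+x. h x \<partial>lborel)"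
proof -
  have "gm_le t (\<integral>\<^sup>+x. f (\<Sum>b\<in>Basis. x b *\<^sub>R b) \<partial>Pi\<^sub>M Basis (\<lambda>_. lborel))
      (\<integral>\<^sup>+x. g (\<Sum>b\<in>Basis. x b *\<^sub>R b) \<partial>Pi\<^sub>M Basis (\<lambda>_. lborel))
      (\<integral>\<^sup>+x. h (\<Sum>b\<in>Basis. x b *\<^sub>R b) \<partial>Pi\<^sub>M Basis (\<lambda>_. lborel))"
  proof (rule Prekopa_Leindler_PiM)
    fix x y :: "'a \<Rightarrow> real"
    have "(\<Sum>b\<in>Basis. (\<lambda>i\<in>Basis. (1 - t) * x i + t * y i) b *\<^sub>R b) =
        (1 - t) *\<^sub>R (\<Sum>b\<in>Basis. x b *\<^sub>R b) + t *\<^sub>R (\<Sum>b\<in>Basis. y b *\<^sub>R b)"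
      by (simp add: scaleR_sum_right sum.distrib[symmetric] scaleR_add_left)
    then show "gm_le t (f (\<Sum>b\<in>Basis. x b *\<^sub>R b)) (g (\<Sum>b\<in>Basis. y b *\<^sub>R b))
        (h (\<Sum>b\<in>Basis. (\<lambda>i\<in>Basis. (1 - t) * x i + t * y i) b *\<^sub>R b))"
      by (simp only: fgh)
  qed (use t in auto)
  then show ?thesis
    by (simp add: nn_integral_lborel_PiM)
qed

section \<open>Log-concave densities on the line\<close>

text \<open>When \<open>s\<close> and \<open>t\<close> have the same sign, both lie between 0 and
  \<open>s + t\<close>, as convex combinations with interchanged weights. Multiplying the two
  log-concavity inequalities makes the exponents at each endpoint add up to 1.\<close>

lemma log_concave_four_point:
  fixes \<psi> :: "real \<Rightarrow> real"
  assumes nn: "\<And>x. 0 \<le> \<psi> x"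
    and lc: "\<And>x y t. 0 < t \<Longrightarrow> t < 1 \<Longrightarrow> \<psi> x powr (1 - t) * \<psi> y powr t \<le> \<psi> ((1 - t) * x + t * y)"
    and st: "0 \<le> s * t"
  shows "\<psi> 0 * \<psi> (s + t) \<le> \<psi> s * \<psi> t"
proof (cases "s = 0 \<or> t = 0")
  case False
  define l where "l = s / (s + t)"
  have ne: "s + t \<noteq> 0" and l: "0 < l" "l < 1"
    using False st by (auto simp: l_def zero_le_mult_iff field_simps)
  have s: "(1 - l) * 0 + l * (s + t) = s" and t: "l * 0 + (1 - l) * (s + t) = t"
    using ne by (auto simp: l_def field_simps)
  have "\<psi> 0 * \<psi> (s + t) = (\<psi> 0 powr (1 - l) * \<psi> (s + t) powr l) * (\<psi> 0 powr l * \<psi> (s + t) powr (1 - l))"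
  proof -
    have "a = a powr (1 - l) * a powr l" if "0 \<le> a" for a :: real
      using that by (simp add: powr_add[symmetric])
    from this[OF nn[of 0]] this[OF nn[of "s + t"]] show ?thesis
      by (metis mult.assoc mult.commute)
  qed
  also have "\<dots> \<le> \<psi> s * \<psi> t"
    using lc[OF l, of 0 "s + t"] lc[of "1 - l" 0 "s + t"] l s t nn by (intro mult_mono) auto
  finally show ?thesis .
qed auto

text \<open>Integrate \<open>four\<close> against \<open>s ^ k\<close> over the quadrant
  \<open>s, t \<ge> 0\<close>. The right side factors; on the left put \<open>u = s + t\<close>, and
  the integral of \<open>s ^ k\<close> over \<open>{0..u}\<close> produces
  \<open>u ^ Suc k / real (Suc k)\<close>. With nonnegative integrals the exchange of order is
  free.\<close>

lemma half_line_moment_aux: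
  fixes \<phi> :: "real \<Rightarrow> real"
  assumes [measurable]: "\<phi> \<in> borel_measurable borel" and nn: "\<And>x. 0 \<le> \<phi> x"
    and four: "\<And>s t. 0 \<le> s \<Longrightarrow> 0 \<le> t \<Longrightarrow> \<phi> 0 * \<phi> (s + t) \<le> \<phi> s * \<phi> t"
  shows "(\<integral>\<^sup>+u. ennreal (indicator {0..} u * (\<phi> 0 * (u ^ Suc k / real (Suc k) * \<phi> u))) \<partial>lborel)
    \<le> (\<integral>\<^sup>+u. ennreal (indicator {0..} u * (u ^ k * \<phi> u)) \<partial>lborel) * (\<integral>\<^sup>+u. ennreal (indicator {0..} u * \<phi> u) \<partial>lborel)"
proof -
  have pow: "(\<integral>\<^sup>+s. ennreal (s ^ k) * indicator {0..u} s \<partial>lborel) = ennreal (u ^ Suc k / real (Suc k))"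
    if "0 \<le> u" for u :: real
  proof -
    have "((\<lambda>s. s ^ Suc k / real (Suc k)) has_real_derivative s ^ k) (at s)" for s :: real
      using DERIV_cdivide[OF DERIV_pow[of "Suc k" s UNIV], of "real (Suc k)"] by (simp del: power_Suc of_nat_Suc)
    then show ?thesis
      using that nn_integral_FTC_Icc[of "\<lambda>s. s ^ k" 0 u "\<lambda>s. s ^ Suc k / real (Suc k)"] by simp
  qed
  have "(\<integral>\<^sup>+u. ennreal (indicator {0..} u * (\<phi> 0 * (u ^ Suc k / real (Suc k) * \<phi> u))) \<partial>lborel) =
      (\<integral>\<^sup>+u. \<integral>\<^sup>+s. ennreal (s ^ k * indicator {0..u} s * (\<phi> 0 * \<phi> u)) \<partial>lborel \<partial>lborel)"
  proof (rule nn_integral_cong)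
    fix u :: real
    show "ennreal (indicator {0..} u * (\<phi> 0 * (u ^ Suc k / real (Suc k) * \<phi> u))) =
      (\<integral>\<^sup>+s. ennreal (s ^ k * indicator {0..u} s * (\<phi> 0 * \<phi> u)) \<partial>lborel)"
    proof (cases "0 \<le> u")
      case True
      have "(\<integral>\<^sup>+s. ennreal (s ^ k * indicator {0..u} s * (\<phi> 0 * \<phi> u)) \<partial>lborel) =
          (\<integral>\<^sup>+s. ennreal (s ^ k) * indicator {0..u} s * ennreal (\<phi> 0 * \<phi> u) \<partial>lborel)"
        using nn by (intro nn_integral_cong) (auto simp: indicator_def ennreal_mult)
      also have "\<dots> = ennreal (u ^ Suc k / real (Suc k)) * ennreal (\<phi> 0 * \<phi> u)"
        using True by (simp add: nn_integral_multc pow del: power_Suc)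
      also have "\<dots> = ennreal (u ^ Suc k / real (Suc k) * (\<phi> 0 * \<phi> u))"
        using True nn by (subst ennreal_mult) auto
      finally show ?thesis using True by (simp add: mult_ac)
    next
      case False
      then have "(\<lambda>s. ennreal (s ^ k * indicator {0..u} s * (\<phi> 0 * \<phi> u))) = (\<lambda>_. 0)"
        by (auto simp: fun_eq_iff)
      then show ?thesis using False by simp
    qed
  qed
  also have "\<dots> = (\<integral>\<^sup>+s. \<integral>\<^sup>+u. ennreal (s ^ k * indicator {0..u} s * (\<phi> 0 * \<phi> u)) \<partial>lborel \<partial>lborel)"
  proof (rule lborel_pair.Fubini')
    have "(\<lambda>(s, u). ennreal (s ^ k * (if 0 \<le> s \<and> s \<le> u then 1 else 0) * (\<phi> 0 * \<phi> u)))
       \<in> borel_measurable (lborel \<Otimes>\<^sub>M lborel)" by measurable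
    then show "(\<lambda>(s, u). ennreal (s ^ k * indicator {0..u} s * (\<phi> 0 * \<phi> u)))
       \<in> borel_measurable (lborel \<Otimes>\<^sub>M lborel)"
      by (simp add: indicator_def)
  qed
  also have "\<dots> \<le> (\<integral>\<^sup>+s. ennreal (indicator {0..} s * (s ^ k * \<phi> s)) *
      (\<integral>\<^sup>+u. ennreal (indicator {0..} u * \<phi> u) \<partial>lborel) \<partial>lborel)"
  proof (rule nn_integral_mono)
    fix s :: real
    have "(\<lambda>u. ennreal (s ^ k * (if 0 \<le> s \<and> s \<le> u then 1 else 0) * (\<phi> 0 * \<phi> u))) \<in> borel_measurable borel"
      by measurable
    then have m: "(\<lambda>u. ennreal (s ^ k * indicator {0..u} s * (\<phi> 0 * \<phi> u))) \<in> borel_measurable borel"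
      by (simp add: indicator_def)
    have "(\<integral>\<^sup>+u. ennreal (s ^ k * indicator {0..u} s * (\<phi> 0 * \<phi> u)) \<partial>lborel) =
        (\<integral>\<^sup>+u. ennreal (s ^ k * indicator {0..s + u} s * (\<phi> 0 * \<phi> (s + u))) \<partial>lborel)"
      using nn_integral_real_affine[OF m, of 1 s] by simp
    also have "\<dots> \<le> (\<integral>\<^sup>+u. ennreal (indicator {0..} s * (s ^ k * \<phi> s)) * ennreal (indicator {0..} u * \<phi> u) \<partial>lborel)"
    proof (rule nn_integral_mono)
      fix u
      show "ennreal (s ^ k * indicator {0..s + u} s * (\<phi> 0 * \<phi> (s + u)))
          \<le> ennreal (indicator {0..} s * (s ^ k * \<phi> s)) * ennreal (indicator {0..} u * \<phi> u)"
      proof (cases "0 \<le> s \<and> 0 \<le> u")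
        case True
        then have "s ^ k * (\<phi> 0 * \<phi> (s + u)) \<le> s ^ k * (\<phi> s * \<phi> u)"
          by (intro mult_left_mono four) auto
        then show ?thesis
          using True nn by (simp add: ennreal_mult[symmetric] ennreal_leI mult.assoc)
      qed (auto simp: indicator_def)
    qed
    also have "\<dots> = ennreal (indicator {0..} s * (s ^ k * \<phi> s)) * (\<integral>\<^sup>+u. ennreal (indicator {0..} u * \<phi> u) \<partial>lborel)"
      by (simp add: nn_integral_cmult)
    finally show "(\<integral>\<^sup>+u. ennreal (s ^ k * indicator {0..u} s * (\<phi> 0 * \<phi> u)) \<partial>lborel) \<le> \<dots>" .
  qed
  also have "\<dots> = (\<integral>\<^sup>+u. ennreal (indicator {0..} u * (u ^ k * \<phi> u)) \<partial>lborel) * (\<integral>\<^sup>+u. ennreal (indicator {0..} u * \<phi> u) \<partial>lborel)"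
    by (simp add: nn_integral_multc)
  finally show ?thesis .
qed

lemma half_line_moment:
  fixes \<phi> :: "real \<Rightarrow> real"
  assumes m[measurable]: "\<phi> \<in> borel_measurable borel" and nn: "\<And>x. 0 \<le> \<phi> x"
    and four: "\<And>s t. 0 \<le> s \<Longrightarrow> 0 \<le> t \<Longrightarrow> \<phi> 0 * \<phi> (s + t) \<le> \<phi> s * \<phi> t"
    and int: "integrable lborel \<phi>" "integrable lborel (\<lambda>u. u ^ k * \<phi> u)" "integrable lborel (\<lambda>u. u ^ Suc k * \<phi> u)"
  shows "\<phi> 0 * (\<integral>u. indicator {0..} u * (u ^ Suc k * \<phi> u) \<partial>lborel)
    \<le> real (Suc k) * (\<integral>u. indicator {0..} u * (u ^ k * \<phi> u) \<partial>lborel) * (\<integral>u. indicator {0..} u * \<phi> u \<partial>lborel)"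
proof -
  have ind: "integrable lborel (\<lambda>u. indicator {0..} u * g u)" if "integrable lborel g" for g :: "real \<Rightarrow> real"
    using integrable_mult_indicator[OF _ that, of "{0..}"] by simp
  have nn': "0 \<le> indicator {0..} u * (u ^ j * \<phi> u)" for j u
    using nn by (auto simp: indicator_def)
  have eq: "(\<integral>\<^sup>+u. ennreal (indicator {0..} u * (u ^ j * \<phi> u)) \<partial>lborel) = ennreal (\<integral>u. indicator {0..} u * (u ^ j * \<phi> u) \<partial>lborel)"
    if "integrable lborel (\<lambda>u. u ^ j * \<phi> u)" for j
    using ind[OF that] nn' by (intro nn_integral_eq_integral) auto
  let ?c = "\<phi> 0 / real (Suc k)"
  have re: "indicator {0..} u * (\<phi> 0 * (u ^ Suc k / real (Suc k) * \<phi> u)) = ?c * (indicator {0..} u * (u ^ Suc k * \<phi> u))" for u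
    by simp
  have "ennreal (?c * (\<integral>u. indicator {0..} u * (u ^ Suc k * \<phi> u) \<partial>lborel)) =
    (\<integral>\<^sup>+u. ennreal (indicator {0..} u * (\<phi> 0 * (u ^ Suc k / real (Suc k) * \<phi> u))) \<partial>lborel)"
    unfolding re using ind[OF int(3)] nn'[of _ "Suc k"] nn[of 0]
    by (subst nn_integral_eq_integral) (auto simp del: power_Suc intro!: AE_I2 divide_nonneg_nonneg mult_nonneg_nonneg)
  also have "\<dots> \<le> ennreal (\<integral>u. indicator {0..} u * (u ^ k * \<phi> u) \<partial>lborel) * ennreal (\<integral>u. indicator {0..} u * \<phi> u \<partial>lborel)"
    using half_line_moment_aux[OF m nn four, of k] eq[OF int(2)] eq[of 0] int(1) by (simp del: power_Suc)
  finally have "?c * (\<integral>u. indicator {0..} u * (u ^ Suc k * \<phi> u) \<partial>lborel)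
     \<le> (\<integral>u. indicator {0..} u * (u ^ k * \<phi> u) \<partial>lborel) * (\<integral>u. indicator {0..} u * \<phi> u \<partial>lborel)"
    using nn' nn'[of _ 0] by (subst (asm) ennreal_mult[symmetric])
      (auto intro!: integral_nonneg_AE mult_nonneg_nonneg simp: ennreal_le_iff simp del: power_Suc)
  then show ?thesis by (simp add: field_simps del: power_Suc)
qed

text \<open>Adding the second-moment bounds of the two half-lines and using \<open>R 1 = L 1\<close>
  and \<open>R 0 + L 0 = 1\<close> gives \<open>\<psi> 0 \<le> 2 * R 1\<close>. One half-line
  carries mass at most 1/2, so its first-moment bound gives
  \<open>\<psi> 0 * R 1 \<le> 1 / 4\<close>. The two together bound the square of
  \<open>\<psi> 0\<close>.\<close>

lemma centered_log_concave_density_at_0: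
  fixes \<psi> :: "real \<Rightarrow> real"
  assumes m[measurable]: "\<psi> \<in> borel_measurable borel" and nn: "\<And>x. 0 \<le> \<psi> x"
    and lc: "\<And>x y t. 0 < t \<Longrightarrow> t < 1 \<Longrightarrow> \<psi> x powr (1 - t) * \<psi> y powr t \<le> \<psi> ((1 - t) * x + t * y)"
    and M0: "has_bochner_integral lborel \<psi> 1"
    and M1: "has_bochner_integral lborel (\<lambda>u. u * \<psi> u) 0"
    and M2: "has_bochner_integral lborel (\<lambda>u. u\<^sup>2 * \<psi> u) v" and v: "1 \<le> v"
  shows "\<psi> 0 \<le> 1"
proof -
  \<comment> \<open>\<open>R\<close> and \<open>L\<close> are the moments of the two half-lines;
    \<open>L\<close> uses the reflected density, so that \<open>half_line_moment\<close> serves both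
    sides.\<close>
  define R where "R k = (\<integral>u. indicator {0..} u * (u ^ k * \<psi> u) \<partial>lborel)" for k
  define L where "L k = (\<integral>u. indicator {0..} u * (u ^ k * \<psi> (- u)) \<partial>lborel)" for k
  have int: "integrable lborel (\<lambda>u. u ^ k * \<psi> u)" if "k \<le> 2" for k
  proof -
    have "k = 0 \<or> k = 1 \<or> k = 2" using that by auto
    then show ?thesis
      using M0 M1 M2 by (auto simp: has_bochner_integral_iff)
  qed
  have refl: "integrable lborel (\<lambda>u. u ^ k * \<psi> (- u))" if "k \<le> 2" for k
  proof -
    have "integrable lborel (\<lambda>u. (- u) ^ k * \<psi> (- u))"
      using lborel_integrable_real_affine[OF int[OF that], of "-1" 0] by simp
    then have "integrable lborel (\<lambda>u. (-1) ^ k * ((- u) ^ k * \<psi> (- u)))"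
      by (rule integrable_mult_right)
    then show ?thesis
      by (simp add: mult.assoc[symmetric] power_mult_distrib[symmetric])
  qed
  have Leq: "L k = (-1) ^ k * (\<integral>u. indicator {..0} u * (u ^ k * \<psi> u) \<partial>lborel)" for k
  proof -
    have "(\<integral>u. indicator {..0} u * (u ^ k * \<psi> u) \<partial>lborel) = (\<integral>u. indicator {..0} (- u) * ((- u) ^ k * \<psi> (- u)) \<partial>lborel)"
      using lborel_integral_real_affine[of "-1" "\<lambda>u. indicator {..0} u * (u ^ k * \<psi> u)" 0] by simp
    also have "\<dots> = (\<integral>u. (-1) ^ k * (indicator {0..} u * (u ^ k * \<psi> (- u))) \<partial>lborel)"
    proof (rule Bochner_Integration.integral_cong)
      show "indicator {..0} (- u) * ((- u) ^ k * \<psi> (- u)) = (-1) ^ k * (indicator {0..} u * (u ^ k * \<psi> (- u)))" for u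
        unfolding power_minus[of u k] by (simp add: indicator_def)
    qed simp
    finally have "(\<integral>u. indicator {..0} u * (u ^ k * \<psi> u) \<partial>lborel) = (-1) ^ k * L k"
      by (simp add: L_def)
    then show ?thesis
      by (simp add: mult.assoc[symmetric] power_mult_distrib[symmetric])
  qed
  have sum: "R k + (-1) ^ k * L k = (\<integral>u. u ^ k * \<psi> u \<partial>lborel)" if k: "k \<le> 2" for k
  proof -
    have ind: "integrable lborel (\<lambda>u. indicator X u * (u ^ k * \<psi> u))" if "X \<in> sets borel" for X
      using integrable_mult_indicator[OF _ int[OF k], of X] that by simp
    have "R k + (-1) ^ k * L k = (\<integral>u. indicator {0..} u * (u ^ k * \<psi> u) + indicator {..0} u * (u ^ k * \<psi> u) \<partial>lborel)"
      using ind by (simp add: R_def Leq mult.assoc[symmetric] power_mult_distrib[symmetric] Bochner_Integration.integral_add)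
    also have "\<dots> = (\<integral>u. u ^ k * \<psi> u \<partial>lborel)"
    proof (rule integral_cong_AE)
      \<comment> \<open>Both closed half-lines contain 0, which is counted twice but is a null
        set.\<close>
      show "AE u in lborel. indicator {0..} u * (u ^ k * \<psi> u) + indicator {..0} u * (u ^ k * \<psi> u) = u ^ k * \<psi> u"
        using AE_lborel_singleton[of "0::real"] by eventually_elim (auto simp: indicator_def)
    qed auto
    finally show ?thesis .
  qed
  have 1: "R 0 + L 0 = 1" and 2: "R 1 = L 1" and 3: "R 2 + L 2 = v"
    using sum[of 0] sum[of 1] sum[of 2] M0 M1 M2 by (auto simp: has_bochner_integral_iff)
  \<comment> \<open>The form \<open>- 0\<close> makes \<open>fourL\<close> an instance of the
    hypothesis of \<open>half_line_moment\<close> for the reflected density.\<close>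
  have fourR: "\<psi> 0 * \<psi> (s + t) \<le> \<psi> s * \<psi> t" and fourL: "\<psi> (- 0) * \<psi> (- (s + t)) \<le> \<psi> (- s) * \<psi> (- t)"
    if "0 \<le> s" "0 \<le> t" for s t
    using log_concave_four_point[OF nn lc, of s t] log_concave_four_point[OF nn lc, of "- s" "- t"] that
    by auto
  have R1: "\<psi> 0 * R 1 \<le> R 0 * R 0"
    using half_line_moment[OF m nn fourR, of 0] int[of 0] int[of 1] by (simp add: R_def)
  have R2: "\<psi> 0 * R 2 \<le> 2 * R 1 * R 0"
    using half_line_moment[OF m nn fourR, of 1] int[of 0] int[of 1] int[of 2] by (simp add: R_def power2_eq_square)
  have m': "(\<lambda>u. \<psi> (- u)) \<in> borel_measurable borel" by measurable
  have L1: "\<psi> 0 * L 1 \<le> L 0 * L 0"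
    using half_line_moment[OF m' nn fourL, of 0] refl[of 0] refl[of 1] by (simp add: L_def)
  have L2: "\<psi> 0 * L 2 \<le> 2 * L 1 * L 0"
    using half_line_moment[OF m' nn fourL, of 1] refl[of 0] refl[of 1] refl[of 2] by (simp add: L_def power2_eq_square)
  have pos: "0 \<le> R k" "0 \<le> L k" for k
    using nn by (auto simp: R_def L_def indicator_def intro!: integral_nonneg_AE AE_I2)
  have "\<psi> 0 * 1 \<le> \<psi> 0 * v"
    using v nn by (intro mult_left_mono) auto
  also have "\<dots> \<le> 2 * R 1 * R 0 + 2 * L 1 * L 0"
    using add_mono[OF R2 L2] 3 by (simp flip: distrib_left)
  also have "\<dots> = 2 * R 1 * (R 0 + L 0)" using 2 by (simp add: algebra_simps)
  finally have q: "\<psi> 0 \<le> 2 * R 1" using 1 by simp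
  have quarter: "\<psi> 0 * R 1 \<le> 1 / 4"
  proof (cases "R 0 \<le> 1 / 2")
    case True
    then have "R 0 * R 0 \<le> 1/2 * (1/2)" using pos by (intro mult_mono) auto
    then show ?thesis using R1 by simp
  next
    case False
    then have "L 0 * L 0 \<le> 1/2 * (1/2)" using pos 1 by (intro mult_mono) auto
    then show ?thesis using L1 2 by simp
  qed
  \<comment> \<open>The right side is at most 1/2; the rounder bound 1 is what is kept.\<close>
  have "\<psi> 0 * \<psi> 0 \<le> \<psi> 0 * (2 * R 1)"
    using q nn by (intro mult_left_mono) auto
  then have "(\<psi> 0)\<^sup>2 \<le> 1\<^sup>2" using quarter by (simp add: power2_eq_square)
  then show ?thesis by (rule power2_le_imp_le) simp
qed

section \<open>Sliding a slab\<close>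

text \<open>Fubini for \<open>h ^ k\<close> on the strip where \<open>h\<close> is within
  \<open>r\<close> of \<open>X x\<close>: integrating over \<open>x\<close> first gives the mass of
  the window at \<open>h\<close>, integrating over \<open>h\<close> first gives the integral of a
  power over an interval of radius \<open>r\<close> about \<open>X x\<close>.\<close>

lemma (in prob_space) has_bochner_integral_sliding_window:
  fixes X :: "'a \<Rightarrow> real"
  assumes [measurable]: "X \<in> borel_measurable M"
    and X: "integrable M X" "integrable M (\<lambda>x. (X x)\<^sup>2)" and r: "0 < r" and k: "k \<le> 2"
  shows "has_bochner_integral lborel (\<lambda>h. h ^ k * measure M {x \<in> space M. \<bar>X x - h\<bar> \<le> r})
    (\<integral>x. ((X x + r) ^ Suc k - (X x - r) ^ Suc k) / real (Suc k) \<partial>M)"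
proof -
  interpret P: pair_sigma_finite M "lborel :: real measure" ..
  define g where "g k x h = h ^ k * indicator {X x - r..X x + r} h" for k x and h :: real
  have [measurable]: "case_prod (g k) \<in> borel_measurable (M \<Otimes>\<^sub>M lborel)" for k
  proof -
    have "(\<lambda>(x, h). h ^ k * (if X x - r \<le> h \<and> h \<le> X x + r then 1 else 0)) \<in> borel_measurable (M \<Otimes>\<^sub>M lborel)"
      by measurable
    then show ?thesis by (simp add: g_def[abs_def] indicator_def)
  qed
  have int_h: "integrable lborel (g k x)" for k x
    unfolding g_def[abs_def] by (rule borel_integrable_atLeastAtMost) simp
  have eval: "(\<integral>h. g k x h \<partial>lborel) = ((X x + r) ^ Suc k - (X x - r) ^ Suc k) / real (Suc k)" for k x
    unfolding g_def using r by (subst integral_power) auto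
  \<comment> \<open>For even \<open>k\<close> the kernel is nonnegative, so its norm has the
    explicit inner integral, a polynomial in \<open>X x\<close> of degree at most 2.\<close>
  have even: "integrable (M \<Otimes>\<^sub>M lborel) (case_prod (g k))" if k: "k = 0 \<or> k = 2" for k
  proof (rule P.Fubini_integrable)
    have "norm (g k x h) = g k x h" for x h
      using k by (auto simp: g_def)
    moreover have "(\<lambda>x. ((X x + r) ^ Suc k - (X x - r) ^ Suc k) / real (Suc k)) =
        (\<lambda>x. if k = 0 then 2 * r else 2 * r * (X x)\<^sup>2 + 2 * r ^ 3 / 3)"
      using k by (auto simp: fun_eq_iff power2_eq_square eval_nat_numeral algebra_simps)
    ultimately show "integrable M (\<lambda>x. \<integral>h. norm (case_prod (g k) (x, h)) \<partial>lborel)"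
      using X by (cases "k = 0") (simp_all add: eval del: power_Suc)
  qed (auto simp: int_h)
  have int: "integrable (M \<Otimes>\<^sub>M lborel) (case_prod (g k))"
  proof (cases "k = 1")
    case True
    have "integrable (M \<Otimes>\<^sub>M lborel) (\<lambda>p. case_prod (g 0) p + case_prod (g 2) p)"
      using even by simp
    then show ?thesis
    proof (rule Bochner_Integration.integrable_bound)
      \<comment> \<open>The odd kernel \<open>g 1\<close> changes sign; it is dominated by the sum
        of the two even ones.\<close>
      have "\<bar>h\<bar> \<le> 1 + h\<^sup>2" for h :: real
        using zero_le_power2[of "\<bar>h\<bar> - 1"] zero_le_power2[of h] by (simp add: power2_diff)
      then show "AE p in M \<Otimes>\<^sub>M lborel. norm (case_prod (g k) p) \<le> norm (case_prod (g 0) p + case_prod (g 2) p)"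
        using True by (auto simp: g_def indicator_def)
    qed auto
  next
    case False
    then show ?thesis using k by (intro even) auto
  qed
  have inner: "(\<integral>x. g k x h \<partial>M) = h ^ k * measure M {x \<in> space M. \<bar>X x - h\<bar> \<le> r}" for h
  proof -
    have "(\<integral>x. g k x h \<partial>M) = (\<integral>x. h ^ k * indicator {x \<in> space M. \<bar>X x - h\<bar> \<le> r} x \<partial>M)"
      unfolding g_def by (intro Bochner_Integration.integral_cong) (auto simp: indicator_def)
    then show ?thesis by simp
  qed
  show ?thesis
    using P.integrable_snd[OF int] P.Fubini_integral[OF int]
    by (simp add: has_bochner_integral_iff inner eval del: power_Suc)
qed

lemma nn_integral_lborel_affine:
  fixes g :: "'a::euclidean_space \<Rightarrow> ennreal"
  assumes [measurable]: "g \<in> borel_measurable borel" and c: "0 < c"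
  shows "(\<integral>\<^sup>+x. g x \<partial>lborel) = ennreal (c ^ DIM('a)) * (\<integral>\<^sup>+x. g (t + c *\<^sub>R x) \<partial>lborel)"
proof -
  have "(\<integral>\<^sup>+x. g x \<partial>lborel) = (\<integral>\<^sup>+x. g x \<partial>density (distr lborel borel (\<lambda>x. t + c *\<^sub>R x)) (\<lambda>_. ennreal (\<bar>c\<bar> ^ DIM('a))))"
    using c by (subst lborel_affine[of c t]) auto
  also have "\<dots> = ennreal (c ^ DIM('a)) * (\<integral>\<^sup>+x. g (t + c *\<^sub>R x) \<partial>lborel)"
    using c by (simp add: nn_integral_density nn_integral_distr nn_integral_cmult)
  finally show ?thesis .
qed

section \<open>Isotropic log-concave measures: moments and slabs\<close>

locale isotropic_log_concave_density =
  fixes M :: "'a::euclidean_space measure" and f :: "'a \<Rightarrow> real"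
  assumes prob: "prob_space M"
    and f_measurable [measurable]: "f \<in> borel_measurable borel"
    and f_nonneg: "0 \<le> f x"
    and M_eq: "M = density lborel (\<lambda>x. ennreal (f x))"
    and f_powr: "0 < t \<Longrightarrow> t < 1 \<Longrightarrow> f x powr (1 - t) * f y powr t \<le> f ((1 - t) *\<^sub>R x + t *\<^sub>R y)"
    and iso: "isotropic M"

sublocale isotropic_log_concave_density \<subseteq> prob_space M
  by (rule prob)

context isotropic_log_concave_density
begin

lemma sets_M [measurable_cong, simp]: "sets M = sets borel"
  by (simp add: M_eq)

lemma space_M [simp]: "space M = UNIV"
  by (simp add: M_eq)

lemma nn_integral_M: "g \<in> borel_measurable borel \<Longrightarrow> (\<integral>\<^sup>+x. g x \<partial>M) = (\<integral>\<^sup>+x. ennreal (f x) * g x \<partial>lborel)"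
  unfolding M_eq by (rule nn_integral_density) auto

lemma emeasure_M: "A \<in> sets borel \<Longrightarrow> emeasure M A = (\<integral>\<^sup>+x. ennreal (f x) * indicator A x \<partial>lborel)"
  unfolding M_eq by (rule emeasure_density) auto

lemma nn_integral_f: "(\<integral>\<^sup>+x. ennreal (f x) \<partial>lborel) = 1"
  using emeasure_space_1 emeasure_M[of UNIV] by simp

lemma first_moment:
  "integrable M (\<lambda>x. x \<bullet> a)" "(\<integral>x. x \<bullet> a \<partial>M) = 0"
  using iso by (auto simp: isotropic_def)

lemma second_moment:
  "integrable M (\<lambda>x. (x \<bullet> a)\<^sup>2)" "(\<integral>x. (x \<bullet> a)\<^sup>2 \<partial>M) = a \<bullet> a"
proof -
  \<comment> \<open>Isotropy is stated for pairs of basis vectors; expanding the square reduces an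
    arbitrary direction to them.\<close>
  have eq: "(x \<bullet> a)\<^sup>2 = (\<Sum>i\<in>Basis. \<Sum>j\<in>Basis. ((x \<bullet> i) * (x \<bullet> j)) * ((a \<bullet> i) * (a \<bullet> j)))" for x
    unfolding euclidean_inner[of x a] power2_eq_square sum_product by (simp add: mult_ac)
  have int: "integrable M (\<lambda>x. ((x \<bullet> i) * (x \<bullet> j)) * ((a \<bullet> i) * (a \<bullet> j)))"
    if "i \<in> Basis" "j \<in> Basis" for i j
    using iso that by (auto simp: isotropic_def)
  show "integrable M (\<lambda>x. (x \<bullet> a)\<^sup>2)"
    unfolding eq by (intro Bochner_Integration.integrable_sum int)
  have "(\<integral>x. (x \<bullet> a)\<^sup>2 \<partial>M) = (\<Sum>i\<in>Basis. \<Sum>j\<in>Basis. (\<integral>x. (x \<bullet> i) * (x \<bullet> j) \<partial>M) * ((a \<bullet> i) * (a \<bullet> j)))"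
    unfolding eq using int by (simp add: Bochner_Integration.integral_sum)
  also have "\<dots> = (\<Sum>i\<in>Basis. \<Sum>j\<in>Basis. (if i = j then 1 else 0) * ((a \<bullet> i) * (a \<bullet> j)))"
    using iso by (intro sum.cong refl) (auto simp: isotropic_def)
  also have "\<dots> = a \<bullet> a"
    by (simp add: euclidean_inner[of a a] if_distrib[where f = "\<lambda>z. z * _"] cong: if_cong)
  finally show "(\<integral>x. (x \<bullet> a)\<^sup>2 \<partial>M) = a \<bullet> a" .
qed

lemma slab_measurable [measurable]: "{x :: 'a. \<bar>x \<bullet> a - h\<bar> \<le> r} \<in> sets borel"
  by measurable

text \<open>Prekopa-Leindler for \<open>f\<close> restricted to slabs: a convex combination of
  points of the slabs centered at \<open>h\<close> and \<open>k\<close> lies in the slab of the same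
  width centered at the combined position, where \<open>f_powr\<close> bounds the density
  below.\<close>

lemma measure_slab_log_concave:
  assumes t: "0 < t" "t < 1"
  shows "measure M {x. \<bar>x \<bullet> a - h\<bar> \<le> r} powr (1 - t) * measure M {x. \<bar>x \<bullet> a - k\<bar> \<le> r} powr t
    \<le> measure M {x. \<bar>x \<bullet> a - ((1 - t) * h + t * k)\<bar> \<le> r}"
proof -
  let ?S = "\<lambda>h. {x. \<bar>x \<bullet> a - h\<bar> \<le> r}"
  let ?k = "(1 - t) * h + t * k"
  have PL: "gm_le t (\<integral>\<^sup>+x. ennreal (f x) * indicator (?S h) x \<partial>lborel)
      (\<integral>\<^sup>+x. ennreal (f x) * indicator (?S k) x \<partial>lborel)
      (\<integral>\<^sup>+x. ennreal (f x) * indicator (?S ?k) x \<partial>lborel)"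
  proof (rule Prekopa_Leindler)
    fix x y :: 'a
    let ?z = "(1 - t) *\<^sub>R x + t *\<^sub>R y"
    show "gm_le t (ennreal (f x) * indicator (?S h) x) (ennreal (f y) * indicator (?S k) y)
        (ennreal (f ?z) * indicator (?S ?k) ?z)"
      unfolding gm_le_def
    proof (intro allI impI)
      fix u v :: real
      assume uv: "0 < u" "0 < v" "ennreal u \<le> ennreal (f x) * indicator (?S h) x"
        "ennreal v \<le> ennreal (f y) * indicator (?S k) y"
      \<comment> \<open>A positive minorant excludes the value 0 outside the slab.\<close>
      have x: "x \<in> ?S h" by (rule ccontr) (use uv(1,3) in simp)
      have y: "y \<in> ?S k" by (rule ccontr) (use uv(2,4) in simp)
      have uv': "u \<le> f x" "v \<le> f y" using uv x y f_nonneg by auto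
      have "u powr (1 - t) * v powr t \<le> f x powr (1 - t) * f y powr t"
        using uv uv' t by (intro mult_mono powr_mono2) auto
      also have "\<dots> \<le> f ?z" using f_powr t by auto
      finally have "u powr (1 - t) * v powr t \<le> f ?z" .
      moreover have "?z \<in> ?S ?k"
      proof -
        have "?z \<bullet> a - ?k = (1 - t) * (x \<bullet> a - h) + t * (y \<bullet> a - k)"
          by (simp add: inner_add_left algebra_simps)
        also have "\<bar>\<dots>\<bar> \<le> (1 - t) * \<bar>x \<bullet> a - h\<bar> + t * \<bar>y \<bullet> a - k\<bar>"
          using t by (intro order_trans[OF abs_triangle_ineq]) (simp add: abs_mult)
        also have "\<dots> \<le> (1 - t) * r + t * r"
          using x y t by (intro add_mono mult_left_mono) auto
        finally show ?thesis by (simp add: algebra_simps)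
      qed
      ultimately show "ennreal (u powr (1 - t) * v powr t) \<le> ennreal (f ?z) * indicator (?S ?k) ?z"
        by (simp add: ennreal_leI)
    qed
  qed (use t in auto)
  have PL': "gm_le t (ennreal (measure M (?S h))) (ennreal (measure M (?S k))) (ennreal (measure M (?S ?k)))"
    using PL by (simp add: emeasure_M[symmetric] emeasure_eq_measure)
  show ?thesis
  proof (cases "measure M (?S h) = 0 \<or> measure M (?S k) = 0")
    case False
    then have "0 < measure M (?S h)" "0 < measure M (?S k)"
      using measure_nonneg[of M "?S h"] measure_nonneg[of M "?S k"] by linarith+
    then show ?thesis
      using PL' unfolding gm_le_def by (auto simp: ennreal_le_iff)
  qed auto
qed

text \<open>The normalized slab mass \<open>\<psi>\<close> is the density of
  \<open>x \<bullet> a\<close> plus an independent uniform variable on \<open>[-r, r]\<close>. It is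
  log-concave and centered, with variance \<open>1 + r\<^sup>2 / 3\<close>, so its value at 0 is at
  most 1.\<close>

lemma measure_central_slab_le:
  assumes a: "norm a = 1" and r: "0 < r"
  shows "measure M {x. \<bar>x \<bullet> a\<bar> \<le> r} \<le> 2 * r"
proof -
  define \<psi> where "\<psi> h = 1 / (2 * r) * measure M {x. \<bar>x \<bullet> a - h\<bar> \<le> r}" for h
  have pos: "0 \<le> \<psi> h" for h using r by (simp add: \<psi>_def)
  have moments: "has_bochner_integral lborel (\<lambda>h. h ^ k * \<psi> h)
      (1 / (2 * r) * (\<integral>x. ((x \<bullet> a + r) ^ Suc k - (x \<bullet> a - r) ^ Suc k) / real (Suc k) \<partial>M))" if "k \<le> 2" for k
    using has_bochner_integral_mult_right[OF has_bochner_integral_sliding_window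
        [of "\<lambda>x. x \<bullet> a", OF _ first_moment(1) second_moment(1) r that], of "1 / (2 * r)"]
    by (simp add: \<psi>_def mult_ac del: power_Suc of_nat_Suc)
  have "\<psi> 0 \<le> 1"
  proof (rule centered_log_concave_density_at_0)
    show M0: "has_bochner_integral lborel \<psi> 1"
      using moments[of 0] r by (simp add: prob_space[simplified])
    show "has_bochner_integral lborel (\<lambda>u. u * \<psi> u) 0"
    proof -
      have "((x \<bullet> a + r) ^ Suc 1 - (x \<bullet> a - r) ^ Suc 1) / real (Suc 1) = 2 * r * (x \<bullet> a)" for x
        by (simp add: algebra_simps)
      then show ?thesis
        using moments[of 1] first_moment(2)[of a] by (simp del: power_Suc of_nat_Suc)
    qed
    show "has_bochner_integral lborel (\<lambda>u. u\<^sup>2 * \<psi> u) (1 + r\<^sup>2 / 3)"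
    proof -
      have "((x \<bullet> a + r) ^ Suc 2 - (x \<bullet> a - r) ^ Suc 2) / real (Suc 2) = 2 * r * ((x \<bullet> a)\<^sup>2 + r\<^sup>2 / 3)" for x
        by (simp add: algebra_simps power2_eq_square power3_eq_cube)
      moreover have "(\<integral>x. (x \<bullet> a)\<^sup>2 + r\<^sup>2 / 3 \<partial>M) = 1 + r\<^sup>2 / 3"
        using second_moment[of a] a by (simp add: prob_space[simplified] dot_square_norm)
      ultimately show ?thesis
        using moments[of 2] r by (simp del: power_Suc of_nat_Suc)
    qed
    show "\<psi> \<in> borel_measurable borel"
      using M0 by (auto simp: has_bochner_integral_iff)
    show "\<psi> x powr (1 - t) * \<psi> y powr t \<le> \<psi> ((1 - t) * x + t * y)" if t: "0 < t" "t < 1" for x y t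
    proof -
      have "\<psi> x powr (1 - t) * \<psi> y powr t = 1 / (2 * r) *
        (measure M {z. \<bar>z \<bullet> a - x\<bar> \<le> r} powr (1 - t) * measure M {z. \<bar>z \<bullet> a - y\<bar> \<le> r} powr t)"
      proof (cases "measure M {z. \<bar>z \<bullet> a - x\<bar> \<le> r} = 0 \<or> measure M {z. \<bar>z \<bullet> a - y\<bar> \<le> r} = 0")
        case False
        then show ?thesis
          unfolding \<psi>_def using r by (intro powr_weighted_mult) (auto simp: zero_less_measure_iff)
      qed (auto simp: \<psi>_def)
      also have "\<dots> \<le> \<psi> ((1 - t) * x + t * y)"
        unfolding \<psi>_def using measure_slab_log_concave[OF t] r by (intro mult_left_mono) auto
      finally show ?thesis .
    qed
  qed (use pos in auto)
  then show ?thesis using r by (simp add: \<psi>_def)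
qed
end

section \<open>Growth of the measure under dilation\<close>

context isotropic_log_concave_density
begin

section \<open>Fradelizi's bound: the density at the barycenter\<close>

lemma f_ln:
  assumes xy: "0 < f x" "0 < f y" and t: "0 < t" "t < 1"
  shows "0 < f ((1 - t) *\<^sub>R x + t *\<^sub>R y)"
    and "(1 - t) * ln (f x) + t * ln (f y) \<le> ln (f ((1 - t) *\<^sub>R x + t *\<^sub>R y))"
proof -
  have pos: "0 < f x powr (1 - t) * f y powr t"
    using xy by simp
  then show z: "0 < f ((1 - t) *\<^sub>R x + t *\<^sub>R y)"
    using f_powr[OF t, of x y] by linarith
  have "(1 - t) * ln (f x) + t * ln (f y) = ln (f x powr (1 - t) * f y powr t)"
    using xy by (simp add: ln_mult ln_powr)
  also have "\<dots> \<le> ln (f ((1 - t) *\<^sub>R x + t *\<^sub>R y))"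
    using pos z f_powr[OF t, of x y] by (subst ln_le_cancel_iff) auto
  finally show "(1 - t) * ln (f x) + t * ln (f y) \<le> ln (f ((1 - t) *\<^sub>R x + t *\<^sub>R y))" .
qed

text \<open>An almost surely nonnegative linear functional with mean 0 vanishes almost surely, yet
  its second moment is \<open>a \<bullet> a\<close>.\<close>

lemma support_not_in_half_space:
  assumes "\<And>x. 0 < f x \<Longrightarrow> 0 \<le> a \<bullet> x"
  shows "a = 0"
proof -
  have nn: "AE x in M. 0 \<le> x \<bullet> a"
  proof -
    have "AE x in lborel. 0 < f x \<longrightarrow> 0 \<le> x \<bullet> a"
      using assms by (simp add: inner_commute)
    then show ?thesis
      unfolding M_eq by (subst AE_density) auto
  qed
  then have "AE x in M. x \<bullet> a = 0"
    using integral_nonneg_eq_0_iff_AE[OF first_moment(1)[of a] nn] first_moment(2)[of a] by simp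
  then have "(\<integral>x. (x \<bullet> a)\<^sup>2 \<partial>M) = (\<integral>x. 0 \<partial>M)"
    by (intro integral_cong_AE) auto
  then show ?thesis
    by (simp add: second_moment(2))
qed

text \<open>The set where \<open>f\<close> is positive is convex; if it missed the origin, a
  hyperplane through 0 would bound a half-space containing it.\<close>

lemma f_0_pos: "0 < f 0"
proof (rule ccontr)
  assume *: "\<not> 0 < f 0"
  have "convex {x. 0 < f x}"
    unfolding convex_alt
  proof (intro ballI allI impI)
    fix x y t assume "x \<in> {x. 0 < f x}" "y \<in> {x. 0 < f x}" "0 \<le> t \<and> t \<le> (1::real)"
    then show "(1 - t) *\<^sub>R x + t *\<^sub>R y \<in> {x. 0 < f x}"
      using f_ln(1)[of x y t] by (cases "t = 0 \<or> t = 1") auto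
  qed
  then obtain a where "a \<noteq> 0" "\<forall>x\<in>{x. 0 < f x}. 0 \<le> a \<bullet> x"
    using separating_hyperplane_set_0[of "{x. 0 < f x}"] * by auto
  then show False using support_not_in_half_space[of a] by auto
qed

text \<open>The strict epigraph of \<open>- ln f\<close>, shifted vertically, is separated from the origin by a
  hyperplane; it is not vertical because no half-space through the barycenter contains the support.\<close>
lemma obtains_supergradient:
  obtains p where "\<And>x. 0 < f x \<Longrightarrow> ln (f x) \<le> ln (f 0) + p \<bullet> x"
proof -
  define E where "E = {(x, s). 0 < f x \<and> ln (f 0) - ln (f x) < s}"
  have "convex E"
    unfolding convex_alt
  proof (intro ballI allI impI)
    fix z w t assume zw: "z \<in> E" "w \<in> E" and t: "0 \<le> t \<and> t \<le> (1::real)"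
    obtain x s y r where z: "z = (x, s)" and w: "w = (y, r)" by (cases z, cases w) auto
    show "(1 - t) *\<^sub>R z + t *\<^sub>R w \<in> E"
    proof (cases "t = 0 \<or> t = 1")
      case False
      then have t': "0 < t" "t < 1" using t by auto
      have pos: "0 < f x" "0 < f y" and sr: "ln (f 0) - ln (f x) < s" "ln (f 0) - ln (f y) < r"
        using zw by (auto simp: E_def z w)
      have "(1 - t) * (ln (f 0) - ln (f x)) + t * (ln (f 0) - ln (f y)) < (1 - t) * s + t * r"
        using sr t' by (intro add_strict_mono mult_strict_left_mono) auto
      then have "ln (f 0) - ((1 - t) * ln (f x) + t * ln (f y)) < (1 - t) * s + t * r"
        by (simp add: algebra_simps)
      then have "ln (f 0) - ln (f ((1 - t) *\<^sub>R x + t *\<^sub>R y)) < (1 - t) * s + t * r"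
        using f_ln(2)[OF pos t'] by linarith
      then show ?thesis
        using f_ln(1)[OF pos t'] by (simp add: E_def z w)
    qed (use zw in auto)
  qed
  moreover have "0 \<notin> E" by (auto simp: E_def zero_prod_def)
  ultimately obtain c where c: "c \<noteq> 0" "\<And>z. z \<in> E \<Longrightarrow> 0 \<le> c \<bullet> z"
    using separating_hyperplane_set_0[of E] by auto
  obtain a b where ab: "c = (a, b)" by (cases c)
  have ineq: "0 \<le> a \<bullet> x + b * s" if "0 < f x" "ln (f 0) - ln (f x) < s" for x s
    using c(2)[of "(x, s)"] that by (simp add: E_def ab)
  have "0 \<le> b"
    using ineq[of 0 1] f_0_pos by simp
  moreover have "b \<noteq> 0"
  proof
    assume "b = 0"
    moreover have "a = 0"
    proof (rule support_not_in_half_space)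
      show "0 \<le> a \<bullet> x" if "0 < f x" for x
        using ineq[OF that, of "ln (f 0) - ln (f x) + 1"] \<open>b = 0\<close> by simp
    qed
    ultimately show False using c(1) by (simp add: ab zero_prod_def)
  qed
  ultimately have b: "0 < b" by simp
  show thesis
  \<comment> \<open>Solving the hyperplane inequality for the vertical coordinate gives slope
    \<open>a / b\<close>. Points of the strict epigraph lie some \<open>e > 0\<close> above the
    graph, and \<open>e\<close> tends to 0.\<close>
  proof (rule that[of "(1 / b) *\<^sub>R a"])
    fix x assume x: "0 < f x"
    have "ln (f x) - ln (f 0) \<le> (1 / b) * (a \<bullet> x)"
    proof (rule field_le_epsilon)
      fix e :: real assume "0 < e"
      then have "0 \<le> a \<bullet> x + b * (ln (f 0) - ln (f x) + e)"
        using x by (intro ineq) auto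
      then have "0 \<le> (a \<bullet> x + b * (ln (f 0) - ln (f x) + e)) / b" using b by simp
      also have "\<dots> = (1 / b) * (a \<bullet> x) + ln (f 0) - ln (f x) + e"
        using b by (simp add: field_simps)
      finally show "ln (f x) - ln (f 0) \<le> (1 / b) * (a \<bullet> x) + e" by simp
    qed
    then show "ln (f x) \<le> ln (f 0) + ((1 / b) *\<^sub>R a) \<bullet> x" by simp
  qed
qed

text \<open>Log-concavity, \<open>exp z \<ge> 1 + z\<close> and the supergradient bound
  \<open>f\<close> at \<open>(1 - l) *\<^sub>R y + l *\<^sub>R x\<close> below by \<open>f x\<close>
  times an affine function of \<open>x\<close>. Integrating, the dilation yields
  \<open>1 / l ^ DIM('a)\<close> on one side, and on the other the linear term vanishes because the
  barycenter is 0. Replacing \<open>ln (f x)\<close> by its affine majorant keeps the integrand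
  integrable.\<close>

lemma dilation_density_bound:
  assumes y: "0 < f y" and l: "0 < l" "l < 1"
  shows "1 + (1 - l) * (ln (f y) - ln (f 0)) \<le> 1 / l ^ DIM('a)"
proof -
  obtain p where p: "\<And>x. 0 < f x \<Longrightarrow> ln (f x) \<le> ln (f 0) + p \<bullet> x"
    using obtains_supergradient by blast
  let ?z = "\<lambda>x. (1 - l) *\<^sub>R y + l *\<^sub>R x"
  let ?L = "ln (f y) - ln (f 0)"
  have ptw: "f x * (1 + (1 - l) * (?L - x \<bullet> p)) \<le> f (?z x)" for x
  proof (cases "0 < f x")
    case True
    have "f x * (1 + (1 - l) * (?L - x \<bullet> p)) \<le> f x * (1 + (1 - l) * (ln (f y) - ln (f x)))"
      using p[OF True] True l by (intro mult_left_mono add_left_mono) (auto simp: inner_commute)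
    also have "\<dots> \<le> f x * exp ((1 - l) * (ln (f y) - ln (f x)))"
      using True by (intro mult_left_mono exp_ge_add_one_self) auto
    also have "\<dots> = exp ((1 - l) * ln (f y) + l * ln (f x))"
      using True by (simp add: exp_diff exp_add algebra_simps)
    also have "\<dots> \<le> exp (ln (f (?z x)))"
      using f_ln(2)[OF y True l] by simp
    also have "\<dots> = f (?z x)" using f_ln(1)[OF y True l] by simp
    finally show ?thesis .
  next
    case False
    then have "f x = 0" using f_nonneg[of x] by simp
    then show ?thesis using f_nonneg by simp
  qed
  have "has_bochner_integral lborel (\<lambda>x. f (?z x)) (1 / l ^ DIM('a))"
  proof (rule has_bochner_integral_nn_integral)
    have "ennreal (l ^ DIM('a)) * (\<integral>\<^sup>+x. ennreal (f (?z x)) \<partial>lborel) = 1"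
      using nn_integral_lborel_affine[of "\<lambda>x. ennreal (f x)" l "(1 - l) *\<^sub>R y"] l nn_integral_f by simp
    then have "ennreal (1 / l ^ DIM('a)) * (ennreal (l ^ DIM('a)) * (\<integral>\<^sup>+x. ennreal (f (?z x)) \<partial>lborel)) = ennreal (1 / l ^ DIM('a))"
      by simp
    moreover have "ennreal (1 / l ^ DIM('a)) * ennreal (l ^ DIM('a)) = 1"
      using l by (simp add: ennreal_mult[symmetric])
    ultimately show "(\<integral>\<^sup>+x. ennreal (f (?z x)) \<partial>lborel) = ennreal (1 / l ^ DIM('a))"
      by (simp add: mult.assoc[symmetric])
  qed (use f_nonneg l in auto)
  then have R: "integrable lborel (\<lambda>x. f (?z x))" "(\<integral>x. f (?z x) \<partial>lborel) = 1 / l ^ DIM('a)"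
    by (auto simp: has_bochner_integral_iff)
  have intM: "integrable M (\<lambda>x. 1 + (1 - l) * (?L - x \<bullet> p))"
    using first_moment(1)[of p] by simp
  have "(\<integral>x. 1 + (1 - l) * (?L - x \<bullet> p) \<partial>M) = 1 + (1 - l) * ?L"
    using first_moment[of p] prob_space by simp
  moreover have "(\<integral>x. 1 + (1 - l) * (?L - x \<bullet> p) \<partial>M) = (\<integral>x. f x * (1 + (1 - l) * (?L - x \<bullet> p)) \<partial>lborel)"
    unfolding M_eq using f_nonneg by (subst integral_density) auto
  moreover have "\<dots> \<le> (\<integral>x. f (?z x) \<partial>lborel)"
  proof (rule integral_mono)
    show "integrable lborel (\<lambda>x. f x * (1 + (1 - l) * (?L - x \<bullet> p)))"
      using intM f_nonneg unfolding M_eq by (subst (asm) integrable_density) auto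
  qed (use R ptw in auto)
  ultimately show ?thesis using R by simp
qed

text \<open>First-order comparison at \<open>l = 1\<close> in \<open>dilation_density_bound\<close>:
  with \<open>l = 1 / (1 + d)\<close> and \<open>d\<close> tending to 0, the quotient on the right
  tends to the derivative of \<open>(1 + d) ^ n\<close> at 0, where
  \<open>n = DIM('a)\<close>.\<close>

lemma ln_f_le_ln_f_0:
  assumes y: "0 < f y"
  shows "ln (f y) - ln (f 0) \<le> real DIM('a)"
proof -
  let ?n = "DIM('a)" and ?L = "ln (f y) - ln (f 0)"
  have le: "?L \<le> (1 + d) * (((1 + d) ^ ?n - 1) / d)" if d: "0 < d" for d
  proof -
    have "1 + (1 - 1 / (1 + d)) * ?L \<le> 1 / (1 / (1 + d)) ^ ?n"
      using d by (intro dilation_density_bound y) auto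
    also have "1 - 1 / (1 + d) = d / (1 + d)" using d by (simp add: field_simps)
    also have "1 / (1 / (1 + d)) ^ ?n = (1 + d) ^ ?n" by (simp add: power_one_over)
    finally have "d / (1 + d) * ?L \<le> (1 + d) ^ ?n - 1" by simp
    then show ?thesis using d by (simp add: field_simps)
  qed
  have "((\<lambda>d. (1 + d) ^ ?n) has_real_derivative real ?n) (at 0)"
    by (auto intro!: derivative_eq_intros)
  then have "((\<lambda>d. ((1 + d) ^ ?n - 1) / d) \<longlongrightarrow> real ?n) (at 0)"
    by (simp add: DERIV_def)
  then have "((\<lambda>d. ((1 + d) ^ ?n - 1) / d) \<longlongrightarrow> real ?n) (at_right 0)"
    by (rule filterlim_mono) (auto simp: at_le)
  then have "((\<lambda>d. (1 + d) * (((1 + d) ^ ?n - 1) / d)) \<longlongrightarrow> (1 + 0) * real ?n) (at_right 0)"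
    by (intro tendsto_intros)
  then have "?L \<le> (1 + 0) * real ?n"
    by (rule tendsto_lowerbound) (use le in \<open>auto simp: eventually_at_right_less eventually_at_filter\<close>)
  then show ?thesis by simp
qed

text \<open>The point \<open>x\<close> divides the segment from 0 to \<open>s *\<^sub>R x\<close>
  with weight \<open>1 / s\<close>. Concavity of \<open>ln f\<close> then extrapolates beyond
  \<open>x\<close> with the increment \<open>ln (f x) - ln (f 0)\<close>, at most the dimension,
  taken \<open>s - 1\<close> times.\<close>

lemma f_scaleR_le:
  assumes s: "1 \<le> s"
  shows "f (s *\<^sub>R x) \<le> f x * exp (real DIM('a) * (s - 1))"
proof (cases "s = 1 \<or> f (s *\<^sub>R x) = 0")
  case True
  then show ?thesis using f_nonneg by auto
next
  case False
  then have s: "1 < s" and pos: "0 < f (s *\<^sub>R x)"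
    using s f_nonneg[of "s *\<^sub>R x"] by auto
  have t: "0 < 1 / s" "1 / s < 1" using s by auto
  have eq: "(1 - 1 / s) *\<^sub>R 0 + (1 / s) *\<^sub>R (s *\<^sub>R x) = x" using s by simp
  note ln = f_ln[OF f_0_pos pos t, unfolded eq]
  have "s * ((1 - 1 / s) * ln (f 0) + (1 / s) * ln (f (s *\<^sub>R x))) \<le> s * ln (f x)"
    using ln(2) s by (intro mult_left_mono) auto
  moreover have "s * ((1 - 1 / s) * ln (f 0) + (1 / s) * ln (f (s *\<^sub>R x))) = (s - 1) * ln (f 0) + ln (f (s *\<^sub>R x))"
    using s by (simp add: distrib_left right_diff_distrib flip: mult.assoc)
  ultimately have "ln (f (s *\<^sub>R x)) \<le> ln (f x) + (s - 1) * (ln (f x) - ln (f 0))"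
    by (simp add: algebra_simps)
  also have "\<dots> \<le> ln (f x) + (s - 1) * real DIM('a)"
    using s by (intro add_left_mono mult_left_mono ln_f_le_ln_f_0 ln(1)) auto
  finally have "exp (ln (f (s *\<^sub>R x))) \<le> exp (ln (f x) + real DIM('a) * (s - 1))"
    by (simp add: mult.commute)
  then show ?thesis using pos ln(1) by (simp add: exp_add)
qed

text \<open>Change of variables contributes \<open>s ^ DIM('a)\<close>, and the pointwise growth of
  the density contributes the exponential.\<close>

lemma measure_dilation_le:
  assumes A: "compact A" and s: "1 \<le> s"
  shows "measure M ((*\<^sub>R) s ` A) \<le> s ^ DIM('a) * exp (real DIM('a) * (s - 1)) * measure M A"
proof -
  have [measurable]: "A \<in> sets borel" "(*\<^sub>R) s ` A \<in> sets borel"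
    using A by (auto intro!: borel_compact compact_scaling)
  have ind: "indicator ((*\<^sub>R) s ` A) (s *\<^sub>R x) = (indicator A x :: ennreal)" for x
    using s by (auto simp: indicator_def)
  have "emeasure M ((*\<^sub>R) s ` A) = (\<integral>\<^sup>+x. ennreal (f x) * indicator ((*\<^sub>R) s ` A) x \<partial>lborel)"
    by (rule emeasure_M) simp
  also have "\<dots> = ennreal (s ^ DIM('a)) * (\<integral>\<^sup>+x. ennreal (f (s *\<^sub>R x)) * indicator A x \<partial>lborel)"
    using s by (subst nn_integral_lborel_affine[of _ s 0]) (auto simp: ind)
  also have "\<dots> \<le> ennreal (s ^ DIM('a)) * (\<integral>\<^sup>+x. ennreal (exp (real DIM('a) * (s - 1))) * (ennreal (f x) * indicator A x) \<partial>lborel)"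
  proof (intro mult_left_mono nn_integral_mono)
    fix x
    have "ennreal (f (s *\<^sub>R x)) \<le> ennreal (exp (real DIM('a) * (s - 1))) * ennreal (f x)"
      using f_scaleR_le[OF s, of x] f_nonneg by (simp add: ennreal_mult[symmetric] ennreal_leI mult.commute)
    then show "ennreal (f (s *\<^sub>R x)) * indicator A x \<le> ennreal (exp (real DIM('a) * (s - 1))) * (ennreal (f x) * indicator A x)"
      by (auto simp: indicator_def)
  qed auto
  also have "\<dots> = ennreal (s ^ DIM('a)) * (ennreal (exp (real DIM('a) * (s - 1))) * emeasure M A)"
    by (simp add: nn_integral_cmult emeasure_M)
  also have "\<dots> = ennreal (s ^ DIM('a) * exp (real DIM('a) * (s - 1)) * measure M A)"
    using s by (simp add: emeasure_eq_measure ennreal_mult mult.assoc)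
  finally show ?thesis
    using s by (simp add: emeasure_eq_measure ennreal_le_iff)
qed
end

section \<open>Symmetric convex bodies\<close>

text \<open>Take \<open>z\<close> on the frontier nearest to 0 and \<open>r = norm z\<close>. The
  ball of radius \<open>r\<close> stays in \<open>A\<close>, and a supporting hyperplane at
  \<open>z\<close> lies within distance \<open>r\<close> of the origin by Cauchy-Schwarz. Symmetry
  supplies the opposite side of the slab.\<close>

lemma symmetric_convex_body_inradius:
  fixes A :: "'a::euclidean_space set"
  assumes A: "symmetric_convex_body A"
  obtains r a where "0 < r" "cball 0 r \<subseteq> A" "norm a = 1" "A \<subseteq> {x. \<bar>x \<bullet> a\<bar> \<le> r}"
proof -
  have cpt: "compact A" and cvx: "convex A" and sym: "uminus ` A = A"
    using A by (auto simp: symmetric_convex_body_def)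
  have neg: "- x \<in> A" if "x \<in> A" for x
    using that sym by auto
  obtain c where c: "c \<in> interior A"
    using A by (auto simp: symmetric_convex_body_def)
  then obtain e where e: "0 < e" "ball c e \<subseteq> A"
    using mem_interior by blast
  have "ball 0 e \<subseteq> A"
  proof
    fix x :: 'a assume x: "x \<in> ball 0 e"
    then have cx: "c + x \<in> A" "c - x \<in> A"
      using e by (auto simp: dist_norm intro!: subsetD[OF e(2)])
    \<comment> \<open>\<open>x\<close> is the midpoint of \<open>c + x\<close> and the reflection of
      \<open>c - x\<close>, so a ball about \<open>c\<close> moves to the origin.\<close>
    have "(1/2) *\<^sub>R (c + x) + (1/2) *\<^sub>R (- (c - x)) \<in> A"
      by (rule convexD[OF cvx cx(1) neg[OF cx(2)]]) auto
    also have "(1/2) *\<^sub>R (c + x) + (1/2) *\<^sub>R (- (c - x)) = (1/2) *\<^sub>R x + (1/2) *\<^sub>R x"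
      by (simp add: algebra_simps)
    also have "\<dots> = x" by (simp flip: scaleR_left_distrib)
    finally show "x \<in> A" .
  qed
  then have zero: "0 \<in> interior A"
    using e(1) mem_interior by blast
  have fr: "compact (frontier A)" "frontier A \<noteq> {}"
    using cpt A not_bounded_UNIV[where 'a='a] by (auto simp: compact_frontier frontier_eq_empty compact_imp_bounded symmetric_convex_body_def)
  obtain z where z: "z \<in> frontier A" "\<And>y. y \<in> frontier A \<Longrightarrow> norm z \<le> norm y"
    using continuous_attains_inf[OF fr, of norm] continuous_on_norm_id by auto
  define r where "r = norm z"
  have "z \<noteq> 0" using z(1) zero by (auto simp: frontier_def)
  then have r: "0 < r" by (simp add: r_def)
  have "ball 0 r \<inter> frontier A = {}"
    using z(2) by (force simp: r_def)
  \<comment> \<open>A connected set that meets \<open>A\<close> and avoids its frontier cannot leave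
    \<open>A\<close>.\<close>
  then have "ball 0 r \<subseteq> A"
    using connected_Int_frontier[of "ball 0 r" A] zero interior_subset[of A] r
    by (auto simp: disjoint_iff) (metis centre_in_ball mem_ball_0 subsetD)
  then have "closure (ball 0 r) \<subseteq> A"
    by (intro closure_minimal compact_imp_closed cpt)
  then have cball: "cball 0 r \<subseteq> A" using r by simp
  have "z \<in> A" using z(1) cpt by (meson compact_imp_closed frontier_subset_closed subsetD)
  have "z \<notin> rel_interior A"
    using z(1) A by (simp add: frontier_def rel_interior_nonempty_interior symmetric_convex_body_def)
  then obtain b where b: "b \<noteq> 0" "\<And>y. y \<in> A \<Longrightarrow> b \<bullet> z \<le> b \<bullet> y"
    using supporting_hyperplane_rel_boundary[OF cvx \<open>z \<in> A\<close>] by metis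
  define a where "a = (1 / norm b) *\<^sub>R b"
  have a: "norm a = 1" using b by (simp add: a_def)
  have low: "- r \<le> y \<bullet> a" if "y \<in> A" for y
  proof -
    have "- (norm b * r) \<le> b \<bullet> z"
      using Cauchy_Schwarz_ineq2[of b z] by (simp add: r_def abs_le_iff)
    then have "- (norm b * r) \<le> b \<bullet> y" using b(2)[OF that] by linarith
    then have "(1 / norm b) * - (norm b * r) \<le> (1 / norm b) * (b \<bullet> y)"
      by (intro mult_left_mono) auto
    then show ?thesis using b(1) by (simp add: a_def inner_commute)
  qed
  have "A \<subseteq> {x. \<bar>x \<bullet> a\<bar> \<le> r}"
    using low low[OF neg] by (fastforce simp: abs_le_iff)
  then show thesis using that r cball a by blast
qed

text \<open>With \<open>s = 1 + e / r\<close>, the vector \<open>(a + b) / s\<close> is a convex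
  combination of \<open>a\<close> and \<open>(r / e) *\<^sub>R b\<close>, with weights
  \<open>1 / s\<close> and \<open>e / (r * s)\<close>. The second point lies in the inscribed
  ball.\<close>

lemma Minkowski_sum_subset_dilation:
  fixes A :: "'a::euclidean_space set"
  assumes A: "convex A" "cball 0 r \<subseteq> A" and r: "0 < r" and e: "0 < e"
  shows "{a + b | a b. a \<in> A \<and> b \<in> cball 0 e} \<subseteq> (*\<^sub>R) (1 + e / r) ` A"
proof clarify
  fix a b :: 'a assume a: "a \<in> A" and b: "b \<in> cball 0 e"
  define s where "s = 1 + e / r"
  have s: "0 < s" using r e by (simp add: s_def add_pos_pos)
  have "1 / s + e / (r * s) = (1 + e / r) / s"
    by (simp add: add_divide_distrib)
  then have s1: "1 / s + e / (r * s) = 1"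
    using s by (simp add: s_def)
  have "(r / e) *\<^sub>R b \<in> cball 0 r"
    using b r e by (simp add: field_simps)
  then have "(1 / s) *\<^sub>R a + (e / (r * s)) *\<^sub>R ((r / e) *\<^sub>R b) \<in> A"
    using A a s s1 r e by (intro convexD) auto
  moreover have "s *\<^sub>R ((1 / s) *\<^sub>R a + (e / (r * s)) *\<^sub>R ((r / e) *\<^sub>R b)) = a + b"
    using s r e by (simp add: scaleR_add_right)
  ultimately show "a + b \<in> (*\<^sub>R) (1 + e / r) ` A"
    unfolding s_def[symmetric] by (metis image_eqI)
qed

section \<open>Boundary measure of a symmetric convex body\<close>

lemma (in isotropic_log_concave_density) boundary_measure_le:
  assumes A: "symmetric_convex_body A"
  shows "boundary_measure M A \<le> ereal (4 * real DIM('a))"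
proof -
  obtain r a where r: "0 < r" and ball: "cball 0 r \<subseteq> A" and a: "norm a = 1" and slab: "A \<subseteq> {x. \<bar>x \<bullet> a\<bar> \<le> r}"
    using symmetric_convex_body_inradius[OF A] by blast
  have cpt: "compact A" and cvx: "convex A"
    using A by (auto simp: symmetric_convex_body_def)
  let ?n = "DIM('a)"
  \<comment> \<open>Growth factor of \<open>measure_dilation_le\<close> at
    \<open>s = 1 + e / r\<close>. It equals 1 at 0, and its two factors each have derivative
    \<open>n / r\<close> there, with \<open>n\<close> the dimension.\<close>
  define G where "G e = (1 + e / r) ^ ?n * exp (real ?n * (e / r))" for e :: real
  have bound: "measure M ({a + b | a b. a \<in> A \<and> b \<in> cball 0 e} - A) / e \<le> (G e - 1) / e * measure M A"
    if e: "0 < e" for e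
  proof -
    define s where "s = 1 + e / r"
    have s: "1 \<le> s" using e r by (simp add: s_def)
    have mA: "A \<in> sets M" and msA: "(*\<^sub>R) s ` A \<in> sets M"
      using cpt by (auto intro!: borel_compact compact_scaling)
    have sub: "A \<subseteq> (*\<^sub>R) s ` A"
    proof
      fix x assume "x \<in> A"
      then have "x \<in> {a + b | a b. a \<in> A \<and> b \<in> cball 0 e}"
        using e by (intro CollectI exI[of _ x] exI[of _ 0]) auto
      then show "x \<in> (*\<^sub>R) s ` A"
        using Minkowski_sum_subset_dilation[OF cvx ball r e] unfolding s_def by (rule rev_subsetD)
    qed
    have "measure M ({a + b | a b. a \<in> A \<and> b \<in> cball 0 e} - A) \<le> measure M ((*\<^sub>R) s ` A - A)"
      using Minkowski_sum_subset_dilation[OF cvx ball r e] mA msA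
      unfolding s_def[symmetric] by (intro finite_measure_mono Diff_mono order_refl sets.Diff)
    also have "\<dots> = measure M ((*\<^sub>R) s ` A) - measure M A"
      by (rule finite_measure_Diff[OF msA mA sub])
    also have "\<dots> \<le> (G e - 1) * measure M A"
      using measure_dilation_le[OF cpt s] by (simp add: s_def G_def algebra_simps)
    finally show ?thesis using e by (simp add: divide_right_mono)
  qed
  have "(G has_real_derivative (2 * real ?n / r)) (at 0)"
    unfolding G_def using r by (auto intro!: derivative_eq_intros)
  then have "((\<lambda>e. (G e - 1) / e) \<longlongrightarrow> 2 * real ?n / r) (at 0)"
    by (simp add: DERIV_def G_def)
  then have "((\<lambda>e. (G e - 1) / e) \<longlongrightarrow> 2 * real ?n / r) (at_right 0)"
    by (rule filterlim_mono) (auto simp: at_le)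
  then have lim: "((\<lambda>e. ereal ((G e - 1) / e * measure M A)) \<longlongrightarrow> ereal (2 * real ?n / r * measure M A)) (at_right 0)"
    by (intro tendsto_ereal tendsto_mult_right)
  have "boundary_measure M A \<le> Liminf (at_right 0) (\<lambda>e. ereal ((G e - 1) / e * measure M A))"
    unfolding boundary_measure_def
    by (rule Liminf_mono) (use bound in \<open>auto simp: eventually_at_filter\<close>)
  also have "\<dots> = ereal (2 * real ?n / r * measure M A)"
    by (rule lim_imp_Liminf[OF _ lim]) simp
  \<comment> \<open>The slab bound is linear in \<open>r\<close> and cancels the
    \<open>1 / r\<close> from the dilation, so the inradius disappears.\<close>
  also have "measure M A \<le> 2 * r"
    using slab by (intro order_trans[OF finite_measure_mono measure_central_slab_le[OF a r]]) auto
  then have "ereal (2 * real ?n / r * measure M A) \<le> ereal (2 * real ?n / r * (2 * r))"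
    using r by (intro ereal_less_eq(3)[THEN iffD2] mult_left_mono) auto
  also have "2 * real ?n / r * (2 * r) = 4 * real ?n" using r by simp
  finally show ?thesis .
qed

theorem theorem1p2:
  fixes M :: "'a::euclidean_space measure"
  assumes "log_concave_measure M" and "isotropic M"
  shows "(SUP A\<in>{A :: 'a set. symmetric_convex_body A}. boundary_measure M A)
           \<le> ereal (4 * real DIM('a))"
proof -
  from assms(1) obtain f :: "'a \<Rightarrow> real" where f: "prob_space M" "f \<in> borel_measurable borel" "\<forall>x. 0 \<le> f x"
    "M = density lborel (\<lambda>x. ennreal (f x))"
    "\<forall>x y t. 0 < t \<and> t < 1 \<longrightarrow> f x powr (1 - t) * f y powr t \<le> f ((1 - t) *\<^sub>R x + t *\<^sub>R y)"
    by (auto simp: log_concave_measure_def simp del: split_paired_All)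
  then interpret isotropic_log_concave_density M f
    using f assms(2) by (intro isotropic_log_concave_density.intro) blast+
  show ?thesis
    by (intro SUP_least boundary_measure_le) simp
qed

end
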